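(* Let $D\ge 2$ be an even integer and let $d$ be a positive integer. Consider the following semidefinite program in the real variables $x^t_{i,j}$, $(i,j,t)\in\mathcal I$: maximize $\displaystyle\sum_{i=0}^{D-1}\binom{2D}{i}x^0_{i,0}+\frac12\binom{2D}{D}x^0_{D,0}$ subject to (1) $x^0_{0,0}=1$; (2) $0\le x^t_{i,j}\le x^0_{i,0}$ for all $(i,j,t)\in\mathcal I$; (3) $x^t_{i,j}=x^{t'}_{i',j'}$ whenever $(i,j,t),(i',j',t')\in\mathcal I$, $0\le i+j-2t\le D$, and $(i',j',i'+j'-2t')$ is a permutation of $(i,j,i+j-2t)$; (4) $x^t_{i,j}=x^{t'}_{i',j'}$ whenever $(i,j,t),(i',j',t')\in\mathcal I$, $D+1\le i+j-2t\le 2D-2$, and $(i',j',2D-(i'+j'-2t'))$ is a permutation of $(i,j,2D-(i+j-2t))$; (5) $x^t_{i,j}=0$ whenever $\{i,j,i+j-2t,2D-(i+j-2t)\}\cap\{1,2,\dots,d-1\}\neq\emptyset$; (6) for each even $r\in\{0,2,\dots,D\}$ the two matrices $\Big(\sum_{t}\beta^r_{i,j,t}x^t_{i,j}\Big)_{i,j=r}^{D}$ and $\Big(\sum_{t}\beta^r_{i,j,t}(x^0_{\zeta,0}-x^t_{i,j})\Big)_{i,j=r}^{D}$ are positive semidefinite, and for each odd $r\in\{1,3,\dots,D-1\}$ the two matrices $\Big(\sum_{t}\beta^r_{i,j,t}x^t_{i,j}\Big)_{i,j=r}^{D-1}$ and $\Big(\sum_{t}\beta^r_{i,j,t}(x^0_{\zeta,0}-x^t_{i,j})\Big)_{i,j=r}^{D-1}$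 are positive semidefinite; here each sum runs over all $t$ with $(i,j,t)\in\mathcal I$, and $\zeta=\min\{i+j-2t,\,2D-(i+j-2t)\}$. Then the optimal value of this semidefinite program is an upper bound on $A(\square_{2D},d)$.
   Context: Let $S=\{1,\dots,2D\}$ and let $X$ be the set of unordered pairs $\{u,u'\}$ of subsets of $S$ with $u\cap u'=\emptyset$ and $u\cup u'=S$. The folded $2D$-cube $\square_{2D}$ is the graph with vertex set $X$ whose path-length distance is $\partial(x,y)=\min\{|x_1\triangle y_1|,|x_1\triangle y_2|\}$ for $x=\{x_1,x_2\}$, $y=\{y_1,y_2\}$ (two vertices are adjacent iff this is $1$); it is distance-regular with diameter $D$. For a graph $\Gamma$, $A(\Gamma,d)$ is the maximum size of a set $C$ of vertices such that $\partial(x,y)\ge d$ for all distinct $x,y\in C$. Index set: $\mathcal I=\{(i,j,t)\in\mathbb Z^3: 0\le t\le i,j\le D,\ i+j-t\le 2D-2,\ t\ge\lfloor (j+1)/2\rfloor \text{ if } i=D,\ t\ge\lfloor (i+1)/2\rfloor\text{ if } j=D\}$. Binomial coefficients $\binom ab$ are $0$ unless $0\le b\le a$. The coefficients $\beta^r_{i,j,t}$ are: (a) for $0\le i,j\le D-1$: $\beta^r_{i,j,t}=\binom{2D-2r}{i-r}\sum_{l=0}^{D-1}(-1)^{r-l}\binom rl\binom{i-l}{t-l}\binom{2D-i-r+l}{j-r-t+l}$; (b) for $i=D$, $0\le j\le D-1$ ($r$ even): $\beta^r_{D,j,t}=2\binom{2D-2r}{D-r}\Big(\sum_{l=\lfloor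 r/2\rfloor+1}^{D-1}(-1)^{r-l}\binom rl\big(\binom{D-l}{t-l}\binom{D-r+l}{j-t-r+l}+\binom{D-r+l}{t-r+l}\binom{D-l}{j-t-l}\big)+\binom{D-r/2}{t-r/2}\binom{D-r/2}{j-t-r/2}(-1)^{r/2}\binom{r}{r/2}\Big)$; (c) for $0\le i\le D-1$, $j=D$: $\beta^r_{i,D,t}=\binom{2D-2r}{i-r}\sum_{l=0}^{D-1}(-1)^{r-l}\binom rl\big(\binom{i-l}{t-l}\binom{2D-r-i+l}{D-r-t+l}+\binom{i-l}{t}\binom{2D-r-i+l}{D-t}\big)$; (d) for $i=j=D$ and $0\le r\le D-1$ ($r$ even): $\beta^r_{D,D,t}=2\binom{2D-2r}{D-r}\Big(\sum_{l=\lfloor r/2\rfloor+1}^{D-1}2(-1)^{r-l}\binom rl\big(\binom{D-l}{t-l}\binom{D-r+l}{t}+\binom{D-l}{t}\binom{D-r+l}{D-t}\big)+2(-1)^{r/2}\binom{r}{r/2}\binom{D-r/2}{D-t}\binom{D-r/2}{t}\Big)$; (e) for $i=j=r=D$: $\beta^D_{D,D,t}=(-1)^{D-t}\binom Dt$ if $t\ge D/2+1$, and $\beta^D_{D,D,D/2}=\frac12(-1)^{D/2}\binom{D}{D/2}$.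
   Formalization: The formal program halves the coefficients β in (b),(c),(d) when i=D, 2t=j or j=D, 2t=i; adds (D,D,D/2) to the index set (new only for D=2); and exempts (0,0,0) from condition (5) (relevant only for d>2D). As printed the bound fails, e.g. for d=1. *)

theory Defs
  imports "HOL-Analysis.Analysis" "HOL-Library.Multiset"
begin

subsection \<open>Codes in the folded cube\<close>

definition folded_cube_vertices :: "nat \<Rightarrow> nat set set set" where
  "folded_cube_vertices D = {{u, u'} | u u'. u \<inter> u' = {} \<and> u \<union> u' = {1..2 * D}}"

definition folded_cube_dist :: "nat set set \<Rightarrow> nat set set \<Rightarrow> nat" where
  "folded_cube_dist x y = Min {card (sym_diff u v) | u v. u \<in> x \<and> v \<in> y}"

lemma folded_cube_dist_eq_min:
  assumes x: "x1 \<inter> x2 = {}" "x1 \<union> x2 = {1..2 * D}"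
    and y: "y1 \<inter> y2 = {}" "y1 \<union> y2 = {1..2 * D}"
  shows "folded_cube_dist {x1, x2} {y1, y2}
    = min (card (sym_diff x1 y1)) (card (sym_diff x1 y2))"
proof -
  have "sym_diff x2 y2 = sym_diff x1 y1" "sym_diff x2 y1 = sym_diff x1 y2"
    using x y by blast+
  then have "{card (sym_diff u v) | u v. u \<in> {x1, x2} \<and> v \<in> {y1, y2}}
    = {card (sym_diff x1 y1), card (sym_diff x1 y2)}"
    by (auto; metis)
  then show ?thesis
    unfolding folded_cube_dist_def by simp
qed

definition is_code :: "'v set \<Rightarrow> ('v \<Rightarrow> 'v \<Rightarrow> nat) \<Rightarrow> nat \<Rightarrow> 'v set \<Rightarrow> bool" where
  "is_code V dst d C \<longleftrightarrow> C \<subseteq> V \<and> (\<forall>x\<in>C. \<forall>y\<in>C. x \<noteq> y \<longrightarrow> d \<le> dst x y)"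

definition max_code_size :: "'v set \<Rightarrow> ('v \<Rightarrow> 'v \<Rightarrow> nat) \<Rightarrow> nat \<Rightarrow> nat" where
  "max_code_size V dst d = Max {card C | C. is_code V dst d C}"

subsection \<open>Indices and coefficients of the semidefinite program\<close>

text \<open>
  The triple \<open>(D, D, D/2)\<close> satisfies the conditions of the first set for every even \<open>D \<ge> 4\<close>.
  For \<open>D = 2\<close> it violates \<open>i + j - t \<le> 2D - 2\<close>, although the vertices given by \<open>{1,2}\<close> and
  \<open>{1,3}\<close> realise it, and without it the program does not bound the size of a code.
\<close>

definition index_set :: "nat \<Rightarrow> (nat \<times> nat \<times> nat) set" where
  "index_set D =
     {(i, j, t). t \<le> i \<and> t \<le> j \<and> i \<le> D \<and> j \<le> D \<and> i + j - t \<le> 2 * D - 2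
        \<and> (i = D \<longrightarrow> (j + 1) div 2 \<le> t) \<and> (j = D \<longrightarrow> (i + 1) div 2 \<le> t)}
     \<union> {(D, D, D div 2)}"

definition bin :: "int \<Rightarrow> int \<Rightarrow> real" where
  "bin a b = (if 0 \<le> b \<and> b \<le> a then real (nat a choose nat b) else 0)"

text \<open>
  In the exponents \<open>r - l\<close> below, truncation for \<open>l > r\<close> is harmless because the factor
  \<open>bin r l\<close> vanishes there. When \<open>i = D\<close> or \<open>j = D\<close> only even \<open>r\<close> are relevant.
\<close>

definition beta_generic :: "nat \<Rightarrow> nat \<Rightarrow> nat \<Rightarrow> nat \<Rightarrow> nat \<Rightarrow> real" where
  "beta_generic D r i j t =
    (if i < D \<and> j < D then
       bin (2 * int D - 2 * int r) (int i - int r) *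
       (\<Sum>l = 0..D - 1. (- 1) ^ (r - l) * bin (int r) (int l)
          * bin (int i - int l) (int t - int l)
          * bin (2 * int D - int i - int r + int l) (int j - int r - int t + int l))
     else if i = D \<and> j < D then
       2 * bin (2 * int D - 2 * int r) (int D - int r) *
       ((\<Sum>l = r div 2 + 1..D - 1. (- 1) ^ (r - l) * bin (int r) (int l) *
           (bin (int D - int l) (int t - int l)
              * bin (int D - int r + int l) (int j - int t - int r + int l)
            + bin (int D - int r + int l) (int t - int r + int l)
              * bin (int D - int l) (int j - int t - int l)))
        + bin (int D - int (r div 2)) (int t - int (r div 2))
          * bin (int D - int (r div 2)) (int j - int t - int (r div 2))
          * (- 1) ^ (r div 2) * bin (int r) (int (r div 2)))
     else if i < D \<and> j = D then
       bin (2 * int D - 2 * int r) (int i - int r) *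
       (\<Sum>l = 0..D - 1. (- 1) ^ (r - l) * bin (int r) (int l) *
          (bin (int i - int l) (int t - int l)
             * bin (2 * int D - int r - int i + int l) (int D - int r - int t + int l)
           + bin (int i - int l) (int t)
             * bin (2 * int D - int r - int i + int l) (int D - int t)))
     else if i = D \<and> j = D \<and> r < D then
       2 * bin (2 * int D - 2 * int r) (int D - int r) *
       ((\<Sum>l = r div 2 + 1..D - 1. 2 * (- 1) ^ (r - l) * bin (int r) (int l) *
           (bin (int D - int l) (int t - int l) * bin (int D - int r + int l) (int t)
            + bin (int D - int l) (int t) * bin (int D - int r + int l) (int D - int t)))
        + 2 * (- 1) ^ (r div 2) * bin (int r) (int (r div 2))
          * bin (int D - int (r div 2)) (int D - int t) * bin (int D - int (r div 2)) (int t))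
     else if i = D \<and> j = D \<and> r = D \<and> D div 2 \<le> t then
       (- 1) ^ (D - t) * bin (int D) (int t)
     else 0)"

text \<open>
  A vertex at distance \<open>D\<close> from \<open>{\<emptyset>, S}\<close> is a pair \<open>{u, S - u}\<close> with \<open>|u| = D\<close>, and a
  \<open>j\<close>-set meeting \<open>u\<close> in \<open>t\<close> points meets \<open>S - u\<close> in \<open>j - t\<close> points. The formulas for \<open>i = D\<close>
  or \<open>j = D\<close> add up the contributions of both members. If these intersections have the same
  size, the two contributions coincide and every pair of vertices is counted twice; the factor
  \<open>1/2\<close> undoes this. For \<open>i = j = r = D\<close> it yields the separate value at \<open>t = D/2\<close>. Without it the program is not satisfied by codes: for the code of all
  vertices and \<open>r = 0\<close>, the minor on the rows \<open>0\<close> and \<open>D\<close> would be negative.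
\<close>

definition beta :: "nat \<Rightarrow> nat \<Rightarrow> nat \<Rightarrow> nat \<Rightarrow> nat \<Rightarrow> real" where
  "beta D r i j t =
    (if (i = D \<and> 2 * t = j) \<or> (j = D \<and> 2 * t = i) then 1 / 2 else 1) * beta_generic D r i j t"

subsection \<open>The semidefinite program\<close>

definition psd_on :: "nat set \<Rightarrow> (nat \<Rightarrow> nat \<Rightarrow> real) \<Rightarrow> bool" where
  "psd_on J M \<longleftrightarrow> (\<forall>i\<in>J. \<forall>j\<in>J. M i j = M j i)
     \<and> (\<forall>v :: nat \<Rightarrow> real. 0 \<le> (\<Sum>i\<in>J. \<Sum>j\<in>J. v i * M i j * v j))"

definition zeta :: "nat \<Rightarrow> nat \<Rightarrow> nat \<Rightarrow> nat \<Rightarrow> nat" where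
  "zeta D i j t = min (i + j - 2 * t) (2 * D - (i + j - 2 * t))"

definition block1 :: "nat \<Rightarrow> (nat \<Rightarrow> nat \<Rightarrow> nat \<Rightarrow> real) \<Rightarrow> nat \<Rightarrow> nat \<Rightarrow> nat \<Rightarrow> real" where
  "block1 D x r i j = (\<Sum>t | (i, j, t) \<in> index_set D. beta D r i j t * x i j t)"

definition block2 :: "nat \<Rightarrow> (nat \<Rightarrow> nat \<Rightarrow> nat \<Rightarrow> real) \<Rightarrow> nat \<Rightarrow> nat \<Rightarrow> nat \<Rightarrow> real" where
  "block2 D x r i j =
     (\<Sum>t | (i, j, t) \<in> index_set D. beta D r i j t * (x (zeta D i j t) 0 0 - x i j t))"

text \<open>
  The variable with lower indices \<open>i, j\<close> and upper index \<open>t\<close> is \<open>x i j t\<close>; values outside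
  \<open>index_set D\<close> play no role. In the fifth condition the exception for \<open>(0, 0, 0)\<close> is vacuous
  for \<open>d \<le> 2D\<close>; for \<open>d > 2D\<close> the condition would otherwise contradict \<open>x 0 0 0 = 1\<close>, since then
  \<open>2D - 0\<close> lies in \<open>{1..d - 1}\<close>.
\<close>

definition sdp_feasible :: "nat \<Rightarrow> nat \<Rightarrow> (nat \<Rightarrow> nat \<Rightarrow> nat \<Rightarrow> real) \<Rightarrow> bool" where
  "sdp_feasible D d x \<longleftrightarrow>
     x 0 0 0 = 1
   \<and> (\<forall>(i, j, t) \<in> index_set D. 0 \<le> x i j t \<and> x i j t \<le> x i 0 0)
   \<and> (\<forall>(i, j, t) \<in> index_set D. \<forall>(i', j', t') \<in> index_set D.
        i + j - 2 * t \<le> D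
        \<and> mset [i', j', i' + j' - 2 * t'] = mset [i, j, i + j - 2 * t]
        \<longrightarrow> x i j t = x i' j' t')
   \<and> (\<forall>(i, j, t) \<in> index_set D. \<forall>(i', j', t') \<in> index_set D.
        D + 1 \<le> i + j - 2 * t \<and> i + j - 2 * t \<le> 2 * D - 2
        \<and> mset [i', j', 2 * D - (i' + j' - 2 * t')] = mset [i, j, 2 * D - (i + j - 2 * t)]
        \<longrightarrow> x i j t = x i' j' t')
   \<and> (\<forall>(i, j, t) \<in> index_set D.
        (i, j, t) \<noteq> (0, 0, 0)
        \<and> {i, j, i + j - 2 * t, 2 * D - (i + j - 2 * t)} \<inter> {1..d - 1} \<noteq> {}
        \<longrightarrow> x i j t = 0)
   \<and> (\<forall>r \<in> {0..D}. even r \<longrightarrow> psd_on {r..D} (block1 D x r) \<and> psd_on {r..D} (block2 D x r))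
   \<and> (\<forall>r \<in> {1..D - 1}. odd r \<longrightarrow>
        psd_on {r..D - 1} (block1 D x r) \<and> psd_on {r..D - 1} (block2 D x r))"

definition sdp_objective :: "nat \<Rightarrow> (nat \<Rightarrow> nat \<Rightarrow> nat \<Rightarrow> real) \<Rightarrow> real" where
  "sdp_objective D x =
     (\<Sum>i = 0..D - 1. real (2 * D choose i) * x i 0 0) + 1 / 2 * real (2 * D choose D) * x D 0 0"

definition sdp_value :: "nat \<Rightarrow> nat \<Rightarrow> ereal" where
  "sdp_value D d = (SUP x \<in> {x. sdp_feasible D d x}. ereal (sdp_objective D x))"

end

theory Submission
  imports Defs "HOL-Combinatorics.Permutations"
begin

text \<open>
  An optimal code \<open>C\<close> lifts to the set \<open>B = \<Union>C\<close> of subsets of \<open>S = {1..2D}\<close>, which is closed under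
  complement. Averaging the indicator of \<open>a \<triangle> \<sigma> u \<in> B \<and> a \<triangle> \<sigma> v \<in> B\<close> over all permutations \<open>\<sigma>\<close> of \<open>S\<close>
  and all \<open>a \<in> B\<close> gives a positive semidefinite kernel in \<open>u, v\<close> that depends only on
  \<open>(|u|, |v|, |u \<inter> v|)\<close>; its values are the feasible point. Averaging over \<open>a \<notin> B\<close> instead gives the
  kernel of the second family of blocks.

  No block diagonalisation is needed. With \<open>g u = \<Prod>k\<le>r. ([k \<in> u] - [k + D \<in> u])\<close>, restricted to the
  \<open>i\<close>-subsets for varying \<open>i\<close>, the numbers \<open>2\<^sup>r \<beta>\<close> are the sums of \<open>g u * g v\<close> over the pairs with
  \<open>|u| = i\<close>, \<open>|v| = j\<close>, \<open>|u \<inter> v| = t\<close>, up to the identification of \<open>t\<close> with \<open>j - t\<close> when \<open>i = D\<close>. So each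
  block is essentially a Gram matrix of the kernel.
\<close>

section \<open>The averaged kernel of a code\<close>

text \<open>The base points \<open>A\<close> are kept apart from the code \<open>B\<close>:
  \<open>A = B\<close> serves the first family of blocks, \<open>A = Pow S - B\<close> the second,
  and \<open>A = Pow S\<close> links the two. The sum is left unnormalised; \<open>point\<close>
  divides by the value at \<open>{}\<close>, \<open>{}\<close>.\<close>

definition code_kernel :: "nat set \<Rightarrow> nat set set \<Rightarrow> nat set set \<Rightarrow> nat set \<Rightarrow> nat set \<Rightarrow> real" where
  "code_kernel S A B u v = (\<Sum>p | p permutes S. \<Sum>a\<in>A.
     of_bool (sym_diff a (p ` u) \<in> B) * of_bool (sym_diff a (p ` v) \<in> B))"

text \<open>The three cardinalities fix the sizes of all four cells of the Venn diagram inside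
  \<open>S\<close>, so a permutation can match the cells one by one. Hence they classify the orbits
  of pairs of subsets.\<close>

lemma ex_permutation_of_set_pair:
  fixes S :: "'a set"
  assumes S: "finite S" and sub: "u \<subseteq> S" "v \<subseteq> S" "u' \<subseteq> S" "v' \<subseteq> S"
    and cards: "card u = card u'" "card v = card v'" "card (u \<inter> v) = card (u' \<inter> v')"
  shows "\<exists>p. p permutes S \<and> p ` u = u' \<and> p ` v = v'"
proof -
  let ?f = "\<lambda>x. (x \<in> u, x \<in> v)" and ?f' = "\<lambda>x. (x \<in> u', x \<in> v')"
  have fib: "card {x \<in> S. (x \<in> a, x \<in> b) = (p, q)}
      = (if p \<and> q then card (a \<inter> b) else if p then card a - card (a \<inter> b)
         else if q then card b - card (a \<inter> b) else card S - (card a + card b - card (a \<inter> b)))"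
    if ab: "a \<subseteq> S" "b \<subseteq> S" for a b p q
  proof -
    have f: "finite a" "finite b" using ab S by (auto intro: finite_subset)
    have "{x \<in> S. (x \<in> a, x \<in> b) = (True, True)} = a \<inter> b"
      "{x \<in> S. (x \<in> a, x \<in> b) = (True, False)} = a - a \<inter> b"
      "{x \<in> S. (x \<in> a, x \<in> b) = (False, True)} = b - a \<inter> b"
      "{x \<in> S. (x \<in> a, x \<in> b) = (False, False)} = S - (a \<union> b)"
      using ab by auto
    moreover have "card (a \<union> b) = card a + card b - card (a \<inter> b)"
      using card_Un_Int[OF f] by linarith
    ultimately show ?thesis
      using f ab S by (cases p; cases q) (simp_all add: card_Diff_subset)
  qed
  \<comment> \<open>Equal cell sizes are phrased as equal multisets of membership patterns, the form
    from which a matching permutation is obtained.\<close>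
  have "image_mset ?f (mset_set S) = image_mset ?f' (mset_set S)"
  proof (rule multiset_eqI)
    fix c :: "bool \<times> bool"
    obtain p q where c: "c = (p, q)" by (cases c)
    have "count (image_mset h (mset_set S)) c = card {x \<in> S. h x = c}" for h :: "'a \<Rightarrow> bool \<times> bool"
      using S by (simp add: count_image_mset vimage_def Int_def conj_commute)
    then show "count (image_mset ?f (mset_set S)) c = count (image_mset ?f' (mset_set S)) c"
      unfolding c using fib[OF sub(1,2), of p q] fib[OF sub(3,4), of p q] cards by simp
  qed
  from image_mset_eq_implies_permutes[OF S this] obtain p
    where p: "p permutes S" and eq: "\<forall>x\<in>S. ?f x = ?f' (p x)" by blast
  have "p ` u = u'" "p ` v = v'"
  proof -
    have "p ` a = a'" if "a \<subseteq> S" "a' \<subseteq> S" "\<And>x. x \<in> S \<Longrightarrow> x \<in> a \<longleftrightarrow> p x \<in> a'" for a a'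
    proof
      show "p ` a \<subseteq> a'" using that by auto
      show "a' \<subseteq> p ` a"
      proof
        fix y assume y: "y \<in> a'"
        then have "y \<in> p ` S" using permutes_image[OF p] that by auto
        then show "y \<in> p ` a" using that y by auto
      qed
    qed
    then show "p ` u = u'" "p ` v = v'" using sub eq by auto
  qed
  then show ?thesis using p by blast
qed

lemma code_kernel_permute:
  assumes "q permutes S"
  shows "code_kernel S A B (q ` u) (q ` v) = code_kernel S A B u v"
  unfolding code_kernel_def
  by (subst (2) sum_permutations_compose_right[OF assms]) (simp add: image_comp)

lemma code_kernel_cong_card:
  assumes "finite S" "u \<subseteq> S" "v \<subseteq> S" "u' \<subseteq> S" "v' \<subseteq> S"
    and "card u = card u'" "card v = card v'" "card (u \<inter> v) = card (u' \<inter> v')"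
  shows "code_kernel S A B u v = code_kernel S A B u' v'"
  using ex_permutation_of_set_pair[OF assms] code_kernel_permute by metis

lemma code_kernel_commute: "code_kernel S A B u v = code_kernel S A B v u"
  unfolding code_kernel_def by (simp add: mult.commute)

lemma code_kernel_nonneg: "0 \<le> code_kernel S A B u v"
  unfolding code_kernel_def by (intro sum_nonneg) auto

text \<open>For fixed \<open>p\<close> and \<open>a\<close> the summand has rank one in
  \<open>u\<close>, \<open>v\<close>, so the quadratic form is a sum of squares.\<close>

lemma code_kernel_psd:
  "0 \<le> (\<Sum>u\<in>U. \<Sum>v\<in>U. f u * code_kernel S A B u v * f v)"
proof -
  let ?h = "\<lambda>p a u. f u * of_bool (sym_diff a (p ` u) \<in> B)"
  have "(\<Sum>u\<in>U. \<Sum>v\<in>U. f u * code_kernel S A B u v * f v)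
      = (\<Sum>u\<in>U. \<Sum>v\<in>U. \<Sum>p | p permutes S. \<Sum>a\<in>A. ?h p a u * ?h p a v)"
    unfolding code_kernel_def by (simp add: sum_distrib_left sum_distrib_right mult_ac)
  also have "\<dots> = (\<Sum>u\<in>U. \<Sum>p | p permutes S. \<Sum>v\<in>U. \<Sum>a\<in>A. ?h p a u * ?h p a v)"
    by (intro sum.cong refl sum.swap)
  also have "\<dots> = (\<Sum>p | p permutes S. \<Sum>u\<in>U. \<Sum>v\<in>U. \<Sum>a\<in>A. ?h p a u * ?h p a v)"
    by (rule sum.swap)
  also have "\<dots> = (\<Sum>p | p permutes S. \<Sum>u\<in>U. \<Sum>a\<in>A. \<Sum>v\<in>U. ?h p a u * ?h p a v)"
    by (intro sum.cong refl sum.swap)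
  also have "\<dots> = (\<Sum>p | p permutes S. \<Sum>a\<in>A. \<Sum>u\<in>U. \<Sum>v\<in>U. ?h p a u * ?h p a v)"
    by (intro sum.cong refl sum.swap)
  also have "\<dots> = (\<Sum>p | p permutes S. \<Sum>a\<in>A. (\<Sum>u\<in>U. ?h p a u)\<^sup>2)"
    by (simp add: power2_eq_square sum_product)
  also have "\<dots> \<ge> 0" by (intro sum_nonneg) auto
  finally show ?thesis .
qed

section \<open>Change of base point and complementation in the kernel\<close>

lemma permutes_image_sym_diff:
  "p permutes S \<Longrightarrow> p ` sym_diff u v = sym_diff (p ` u) (p ` v)"
  by (simp add: image_Un image_set_diff permutes_inj)

lemma permutes_image_Diff:
  "p permutes S \<Longrightarrow> p ` (S - u) = S - p ` u"
  by (simp add: image_set_diff permutes_inj permutes_image)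

lemma permutes_image_subset:
  "p permutes S \<Longrightarrow> u \<subseteq> S \<Longrightarrow> p ` u \<subseteq> S"
  using permutes_image by blast

text \<open>A nonzero summand belongs to three words of \<open>B\<close>: the base \<open>a\<close>
  and its translates by the images of \<open>u\<close> and \<open>v\<close>. Taking the third word
  as the new base is an involution on the possible bases, and relative to it the second word is the
  translate by the image of \<open>sym_diff u v\<close>.\<close>

lemma code_kernel_translate:
  assumes fin: "finite B"
  shows "code_kernel S B B (sym_diff u v) v = code_kernel S B B u v"
proof -
  have fS: "\<And>p. p permutes S \<Longrightarrow> (\<Sum>a\<in>B. of_bool (sym_diff a (p ` sym_diff u v) \<in> B) * of_bool (sym_diff a (p ` v) \<in> B))
     = (\<Sum>a\<in>B. of_bool (sym_diff a (p ` u) \<in> B) * of_bool (sym_diff a (p ` v) \<in> B) :: real)"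
  proof -
    fix p assume p: "p permutes S"
    let ?F = "\<lambda>a. of_bool (sym_diff a (p ` sym_diff u v) \<in> B) * of_bool (sym_diff a (p ` v) \<in> B) :: real"
    let ?G = "\<lambda>a. of_bool (sym_diff a (p ` u) \<in> B) * of_bool (sym_diff a (p ` v) \<in> B) :: real"
    have tw: "sym_diff (sym_diff a (p ` v)) (p ` v) = a"
      "sym_diff (sym_diff a (p ` v)) (p ` sym_diff u v) = sym_diff a (p ` u)"
      "sym_diff (sym_diff a (p ` v)) (p ` u) = sym_diff a (p ` sym_diff u v)" for a
      unfolding permutes_image_sym_diff[OF p] by blast+
    let ?B = "{a \<in> B. sym_diff a (p ` v) \<in> B}"
    have "sum ?F B = (\<Sum>a\<in>?B. of_bool (sym_diff a (p ` sym_diff u v) \<in> B))"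
      using fin by (intro sum.mono_neutral_cong_right) auto
    also have "\<dots> = (\<Sum>a\<in>?B. of_bool (sym_diff a (p ` u) \<in> B))"
      by (rule sum.reindex_bij_witness[where i = "\<lambda>a. sym_diff a (p ` v)"
            and j = "\<lambda>a. sym_diff a (p ` v)"]) (simp_all only: mem_Collect_eq tw)
    also have "\<dots> = sum ?G B"
      using fin by (intro sum.mono_neutral_cong_left) auto
    finally show "sum ?F B = sum ?G B" .
  qed
  then show ?thesis unfolding code_kernel_def by simp
qed

text \<open>With arbitrary base points only the two translates are constrained to lie in
  \<open>B\<close>. Moving the base to the second of them leaves a count of pairs of words of
  \<open>B\<close> that differ by an image of \<open>sym_diff u v\<close>.\<close>

lemma code_kernel_Pow:
  assumes S: "finite S" and B: "B \<subseteq> Pow S" and v: "v \<subseteq> S"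
  shows "code_kernel S (Pow S) B u v = code_kernel S B B (sym_diff u v) {}"
proof -
  have "(\<Sum>a\<in>Pow S. of_bool (sym_diff a (p ` u) \<in> B) * of_bool (sym_diff a (p ` v) \<in> B))
     = (\<Sum>a\<in>B. of_bool (sym_diff a (p ` sym_diff u v) \<in> B) * of_bool (sym_diff a (p ` {}) \<in> B) :: real)"
    if p: "p permutes S" for p
  proof -
    have tw: "sym_diff (sym_diff a (p ` v)) (p ` v) = a"
      "sym_diff (sym_diff a (p ` v)) (p ` sym_diff u v) = sym_diff a (p ` u)"
      "sym_diff (sym_diff a (p ` v)) (p ` u) = sym_diff a (p ` sym_diff u v)" for a
      unfolding permutes_image_sym_diff[OF p] by blast+
    let ?B = "{a \<in> Pow S. sym_diff a (p ` v) \<in> B}"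
    have mem: "sym_diff a (p ` v) \<in> Pow S" if "a \<in> B" for a
      using that B permutes_image_subset[OF p v] by blast
    have "(\<Sum>a\<in>Pow S. of_bool (sym_diff a (p ` u) \<in> B) * of_bool (sym_diff a (p ` v) \<in> B))
        = (\<Sum>a\<in>?B. of_bool (sym_diff a (p ` u) \<in> B) :: real)"
      using S by (intro sum.mono_neutral_cong_right) auto
    also have "\<dots> = (\<Sum>a\<in>B. of_bool (sym_diff a (p ` sym_diff u v) \<in> B))"
      by (rule sum.reindex_bij_witness[where i = "\<lambda>a. sym_diff a (p ` v)"
            and j = "\<lambda>a. sym_diff a (p ` v)"]) (use mem in \<open>simp_all only: mem_Collect_eq tw\<close>)
    also have "\<dots> = (\<Sum>a\<in>B. of_bool (sym_diff a (p ` sym_diff u v) \<in> B) * of_bool (sym_diff a (p ` {}) \<in> B))"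
      by (intro sum.cong) auto
    finally show ?thesis .
  qed
  then show ?thesis unfolding code_kernel_def by simp
qed

text \<open>Source of the differences in the entries of the second family: the minuend counts pairs
  of words and becomes the variable with index \<open>zeta\<close>.\<close>

lemma code_kernel_compl_base:
  assumes S: "finite S" and B: "B \<subseteq> Pow S" and v: "v \<subseteq> S"
  shows "code_kernel S (Pow S - B) B u v = code_kernel S B B (sym_diff u v) {} - code_kernel S B B u v"
proof -
  have "code_kernel S (Pow S - B) B u v = code_kernel S (Pow S) B u v - code_kernel S B B u v"
    unfolding code_kernel_def sum_subtractf[symmetric]
    by (intro sum.cong refl sum_diff) (use S B in auto)
  then show ?thesis using code_kernel_Pow[OF assms] by simp
qed

text \<open>Complementing \<open>u\<close> complements the translated word, and \<open>B\<close> is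
  closed under complement. This is how the identification of antipodes enters the kernel.\<close>

lemma code_kernel_Diff:
  assumes A: "A \<subseteq> Pow S" and B: "\<And>b. b \<in> B \<Longrightarrow> S - b \<in> B" and u: "u \<subseteq> S"
  shows "code_kernel S A B (S - u) v = code_kernel S A B u v"
proof -
  have "sym_diff a (p ` (S - u)) \<in> B \<longleftrightarrow> sym_diff a (p ` u) \<in> B"
    if p: "p permutes S" and a: "a \<in> A" for p a
  proof -
    have pu: "p ` u \<subseteq> S" using permutes_image_subset[OF p u] .
    have "sym_diff a (p ` (S - u)) = S - sym_diff a (p ` u)"
      "sym_diff a (p ` u) = S - sym_diff a (p ` (S - u))"
      unfolding permutes_image_Diff[OF p] using a A pu by blast+
    then show ?thesis using B by metis
  qed
  then show ?thesis unfolding code_kernel_def by (auto intro!: sum.cong)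
qed

text \<open>For \<open>v = {}\<close> the second word is the base \<open>a\<close> itself, so its
  factor takes the largest possible value 1.\<close>

lemma code_kernel_le_diagonal:
  "code_kernel S B B u v \<le> code_kernel S B B u {}"
  unfolding code_kernel_def by (intro sum_mono) (auto simp: of_bool_def)

lemma code_kernel_empty:
  assumes "finite S"
  shows "code_kernel S B B {} {} = fact (card S) * card B"
  unfolding code_kernel_def using card_permutations[OF refl assms] by simp

section \<open>Signed orbit sums\<close>

lemma card_subsets_eq_bin:
  assumes "finite X"
  shows "real (card {a. a \<subseteq> X \<and> int (card a) = z}) = bin (int (card X)) z"
proof (cases "0 \<le> z")
  case True
  then have "{a. a \<subseteq> X \<and> int (card a) = z} = {a. a \<subseteq> X \<and> card a = nat z}" by auto
  then show ?thesis using True n_subsets[OF assms, of "nat z"] by (auto simp: bin_def)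
next
  case False
  then have "{a. a \<subseteq> X \<and> int (card a) = z} = {}" by auto
  then show ?thesis using False by (simp add: bin_def)
qed

lemma bin_symmetric: "bin a b = bin a (a - b)"
  by (auto simp: bin_def nat_diff_distrib binomial_symmetric[of "nat b" "nat a"])

text \<open>A set \<open>v\<close> above \<open>w\<close> is \<open>w\<close> together with a part
  of \<open>u - w\<close> and a part of \<open>S - u - w\<close>, chosen independently; the
  prescribed sizes fix how large both parts are. Working over the integers covers impossible sizes,
  where \<open>bin\<close> and the count both vanish.\<close>

lemma card_supersets_eq_bin:
  assumes S: "finite S" and u: "u \<subseteq> S" and w: "w \<subseteq> S"
  shows "real (card {v. w \<subseteq> v \<and> v \<subseteq> S \<and> card v = j \<and> card (u \<inter> v) = t})
    = bin (int (card u) - int (card (u \<inter> w))) (int t - int (card (u \<inter> w)))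
      * bin (int (card S) - int (card u) - int (card w) + int (card (u \<inter> w)))
          (int j - int (card w) - int t + int (card (u \<inter> w)))"
proof -
  let ?m = "card (u \<inter> w)"
  let ?A = "{a. a \<subseteq> u - w \<and> int (card a) = int t - int ?m}"
  let ?B = "{b. b \<subseteq> S - u - w \<and> int (card b) = int j - int (card w) - int t + int ?m}"
  let ?h = "\<lambda>(a, b). w \<union> a \<union> b"
  have fin: "finite u" "finite w" using S u w by (auto intro: finite_subset)
  have inj: "inj_on ?h (?A \<times> ?B)"
    by (rule inj_on_inverseI[where g = "\<lambda>v. ((v \<inter> u) - w, v - u - w)"]) auto
  have cards: "card (w \<union> a \<union> b) = card w + card a + card b"
    "card (u \<inter> (w \<union> a \<union> b)) = ?m + card a"
    if "a \<subseteq> u - w" "b \<subseteq> S - u - w" for a b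
  proof -
    have f: "finite a" "finite b" using that S u by (auto intro: finite_subset)
    have "card (w \<union> a) = card w + card a" using that f fin by (intro card_Un_disjoint) auto
    moreover have "card (w \<union> a \<union> b) = card (w \<union> a) + card b"
      using that f fin by (intro card_Un_disjoint) auto
    ultimately show "card (w \<union> a \<union> b) = card w + card a + card b" by simp
    have "u \<inter> (w \<union> a \<union> b) = (u \<inter> w) \<union> a" using that by blast
    moreover have "card ((u \<inter> w) \<union> a) = ?m + card a"
      using that f fin by (intro card_Un_disjoint) auto
    ultimately show "card (u \<inter> (w \<union> a \<union> b)) = ?m + card a" by simp
  qed
  have "{v. w \<subseteq> v \<and> v \<subseteq> S \<and> card v = j \<and> card (u \<inter> v) = t} = ?h ` (?A \<times> ?B)"
  proof (intro set_eqI iffI)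
    fix v assume "v \<in> {v. w \<subseteq> v \<and> v \<subseteq> S \<and> card v = j \<and> card (u \<inter> v) = t}"
    then have v: "w \<subseteq> v" "v \<subseteq> S" "card v = j" "card (u \<inter> v) = t" by auto
    let ?a = "(v \<inter> u) - w" and ?b = "v - u - w"
    have eq: "v = w \<union> ?a \<union> ?b" using v by auto
    have sub: "?a \<subseteq> u - w" "?b \<subseteq> S - u - w" using v by auto
    have "j = card w + card ?a + card ?b" "t = ?m + card ?a"
      using cards[OF sub] eq v by auto
    then have "(?a, ?b) \<in> ?A \<times> ?B" using sub by auto
    moreover have "v = ?h (?a, ?b)" using eq by simp
    ultimately show "v \<in> ?h ` (?A \<times> ?B)" by (rule rev_image_eqI)
  next
    fix v assume "v \<in> ?h ` (?A \<times> ?B)"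
    then obtain a b where ab: "a \<in> ?A" "b \<in> ?B" "v = w \<union> a \<union> b" by auto
    then have "a \<subseteq> u - w" "b \<subseteq> S - u - w" by auto
    from cards[OF this] ab u w
    show "v \<in> {v. w \<subseteq> v \<and> v \<subseteq> S \<and> card v = j \<and> card (u \<inter> v) = t}" by auto
  qed
  then have "real (card {v. w \<subseteq> v \<and> v \<subseteq> S \<and> card v = j \<and> card (u \<inter> v) = t}) = real (card ?A) * real (card ?B)"
    by (simp add: card_image[OF inj] card_cartesian_product)
  moreover have "real (card ?A) = bin (int (card u) - int ?m) (int t - int ?m)"
  proof -
    have "card (u - w) = card u - ?m" by (metis card_Diff_subset_Int fin finite_Int)
    moreover have "?m \<le> card u" using fin by (intro card_mono) auto
    ultimately show ?thesis using card_subsets_eq_bin[of "u - w"] fin by (simp add: of_nat_diff)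
  qed
  moreover have "real (card ?B) = bin (int (card S) - int (card u) - int (card w) + int ?m)
      (int j - int (card w) - int t + int ?m)"
  proof -
    have "S - u - w = S - (u \<union> w)" by auto
    moreover have "card (S - (u \<union> w)) = card S - card (u \<union> w)"
      using fin u w by (intro card_Diff_subset) auto
    moreover have "card (u \<union> w) \<le> card S" using S u w by (intro card_mono) auto
    moreover have "card u + card w = card (u \<union> w) + ?m" using card_Un_Int[OF fin] .
    ultimately have "int (card (S - u - w)) = int (card S) - int (card u) - int (card w) + int ?m"
      by (simp add: of_nat_diff)
    then show ?thesis using card_subsets_eq_bin[of "S - u - w"] S by simp
  qed
  ultimately show ?thesis by simp
qed

lemma sum_Pow_card:
  fixes F :: "nat \<Rightarrow> real"
  assumes "finite A"
  shows "(\<Sum>L\<in>Pow A. F (card L)) = (\<Sum>l = 0..card A. real (card A choose l) * F l)"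
proof -
  have "(\<Sum>L\<in>Pow A. F (card L)) = (\<Sum>l = 0..card A. \<Sum>L | L \<in> Pow A \<and> card L = l. F (card L))"
    by (rule sum.group[symmetric]) (use assms in \<open>auto intro: card_mono\<close>)
  also have "\<dots> = (\<Sum>l = 0..card A. real (card A choose l) * F l)"
    by (intro sum.cong refl) (use n_subsets[OF assms] in simp)
  finally show ?thesis .
qed

text \<open>For \<open>r \<le> D\<close> this is the Specht polynomial of the two-row shape
  \<open>(2D - r, r)\<close> at the indicator vector of \<open>u\<close>; the columns of length two
  are the pairs \<open>k\<close>, \<open>k + D\<close>.\<close>

definition pair_sign :: "nat \<Rightarrow> nat \<Rightarrow> nat set \<Rightarrow> real" where
  "pair_sign D r u = (\<Prod>k = 1..r. of_bool (k \<in> u) - of_bool (k + D \<in> u))"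

definition transversal :: "nat \<Rightarrow> nat \<Rightarrow> nat set \<Rightarrow> bool" where
  "transversal D r u \<longleftrightarrow> (\<forall>k \<in> {1..r}. (k \<in> u) \<noteq> (k + D \<in> u))"

text \<open>Case (a) of the coefficients with the sum stopped at \<open>r\<close>, beyond which
  \<open>bin r l\<close> vanishes. It is used for all \<open>i\<close>, \<open>j\<close>, including
  \<open>D\<close>, as the common yardstick for the other cases.\<close>

definition orbit_coeff :: "nat \<Rightarrow> nat \<Rightarrow> nat \<Rightarrow> nat \<Rightarrow> nat \<Rightarrow> real" where
  "orbit_coeff D r i j t = bin (2 * int D - 2 * int r) (int i - int r) *
     (\<Sum>l = 0..r. (- 1) ^ (r - l) * bin (int r) (int l)
        * bin (int i - int l) (int t - int l)
        * bin (2 * int D - int i - int r + int l) (int j - int r - int t + int l))"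

lemma pair_sign_eq_0: "\<not> transversal D r u \<Longrightarrow> pair_sign D r u = 0"
  unfolding transversal_def pair_sign_def by (force intro: prod_zero)

text \<open>Each factor changes sign. Complementation maps the \<open>D\<close>-sets to themselves,
  and it preserves \<open>pair_sign\<close> when \<open>r\<close> is even, the parity for which the
  blocks contain the index \<open>D\<close>.\<close>

lemma pair_sign_Diff:
  assumes "r \<le> D"
  shows "pair_sign D r ({1..2 * D} - u) = (- 1) ^ r * pair_sign D r u"
proof -
  have "pair_sign D r ({1..2 * D} - u) = (\<Prod>k = 1..r. - 1 * (of_bool (k \<in> u) - of_bool (k + D \<in> u)))"
    unfolding pair_sign_def using assms by (intro prod.cong) auto
  also have "\<dots> = (- 1) ^ r * pair_sign D r u"
    unfolding pair_sign_def prod.distrib by simp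
  finally show ?thesis .
qed

text \<open>Expanding the product of signs over the sets \<open>L\<close> of pairs turns the sum
  into signed counts of those \<open>v\<close> that contain \<open>w L\<close>. Each
  \<open>w L\<close> has \<open>r\<close> elements, \<open>card L\<close> of them in
  \<open>u\<close>, so \<open>card_supersets_eq_bin\<close> gives a count that depends on
  \<open>card L\<close> alone.\<close>

lemma pair_sign_mult_sum:
  assumes r: "r \<le> D" and u: "u \<subseteq> {1..2 * D}" "transversal D r u"
  shows "(\<Sum>v | v \<subseteq> {1..2 * D} \<and> card v = j \<and> card (u \<inter> v) = t. pair_sign D r u * pair_sign D r v)
    = (\<Sum>l = 0..r. (- 1) ^ (r - l) * bin (int r) (int l)
        * bin (int (card u) - int l) (int t - int l)
        * bin (2 * int D - int (card u) - int r + int l) (int j - int r - int t + int l))"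
proof -
  let ?S = "{1..2 * D}" and ?R = "{1..r}"
  let ?V = "{v. v \<subseteq> ?S \<and> card v = j \<and> card (u \<inter> v) = t}"
  \<comment> \<open>\<open>e k\<close> is the member of the pair \<open>k\<close>,
    \<open>k + D\<close> that lies in \<open>u\<close>, and \<open>e' k\<close> is the other one;
    \<open>w L\<close> agrees with \<open>u\<close> on the pairs in \<open>L\<close> and opposes it
    on the rest.\<close>
  define e where "e k = (if k \<in> u then k else k + D)" for k
  define e' where "e' k = (if k \<in> u then k + D else k)" for k
  define w where "w L = e ` L \<union> e' ` (?R - L)" for L
  have e_in: "e k \<in> u" "e' k \<notin> u" if "k \<in> ?R" for k
    using u(2) that by (auto simp: transversal_def e_def e'_def)
  have e_S: "e k \<in> ?S" "e' k \<in> ?S" if "k \<in> ?R" for k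
    using that r by (auto simp: e_def e'_def)
  have inj: "inj_on e ?R" "inj_on e' ?R"
    using r by (auto simp: inj_on_def e_def e'_def split: if_splits)
  have w_S: "w L \<subseteq> ?S" if "L \<subseteq> ?R" for L
    using that e_S by (auto simp: w_def)
  have card_uw: "card (u \<inter> w L) = card L" if "L \<subseteq> ?R" for L
  proof -
    have "u \<inter> w L = e ` L" using that e_in by (auto simp: w_def)
    then show ?thesis using card_image[OF inj_on_subset[OF inj(1) that]] by simp
  qed
  have card_w: "card (w L) = r" if "L \<subseteq> ?R" for L
  proof -
    have "finite L" using that finite_subset by blast
    moreover have "e ` L \<subseteq> u" "e' ` (?R - L) \<inter> u = {}" using that e_in by auto
    then have "e ` L \<inter> e' ` (?R - L) = {}" by blast
    ultimately have "card (w L) = card (e ` L) + card (e' ` (?R - L))"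
      unfolding w_def by (intro card_Un_disjoint) auto
    also have "\<dots> = card L + card (?R - L)"
      using card_image[OF inj_on_subset[OF inj(1) that]] card_image[OF inj_on_subset[OF inj(2), of "?R - L"]]
      by auto
    also have "\<dots> = r" using that card_mono[OF _ that] \<open>finite L\<close> by (simp add: card_Diff_subset)
    finally show ?thesis .
  qed
  \<comment> \<open>Multiplying by \<open>pair_sign D r u\<close> flips each factor so that the element of the pair lying in
    \<open>u\<close> counts positively; hence only \<open>card (u \<inter> w L) = card L\<close> matters in the expansion.\<close>
  have expand: "pair_sign D r u * pair_sign D r v = (\<Sum>L\<in>Pow ?R. (- 1) ^ (r - card L) * of_bool (w L \<subseteq> v))" for v
  proof -
    have "pair_sign D r u * pair_sign D r v = (\<Prod>k\<in>?R. of_bool (e k \<in> v) - of_bool (e' k \<in> v))"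
      unfolding pair_sign_def prod.distrib[symmetric]
      using u(2) by (intro prod.cong) (auto simp: transversal_def e_def e'_def)
    also have "\<dots> = (\<Sum>L\<in>Pow ?R. (- 1) ^ (card ?R - card L) * (\<Prod>k\<in>L. of_bool (e k \<in> v)) * (\<Prod>k\<in>?R - L. of_bool (e' k \<in> v)))"
      by (rule prod_diff_conv_sum') simp
    also have "\<dots> = (\<Sum>L\<in>Pow ?R. (- 1) ^ (r - card L) * of_bool (w L \<subseteq> v))"
    proof (intro sum.cong refl)
      fix L assume "L \<in> Pow ?R"
      then have f: "finite L" "finite (?R - L)" using finite_subset by auto
      have pb: "(\<Prod>k\<in>X. of_bool (P k)) = (of_bool (\<forall>k\<in>X. P k) :: real)" if "finite X" for X :: "nat set" and P
        using that by (induction X) auto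
      show "(- 1) ^ (card ?R - card L) * (\<Prod>k\<in>L. of_bool (e k \<in> v)) * (\<Prod>k\<in>?R - L. of_bool (e' k \<in> v))
          = (- 1) ^ (r - card L) * (of_bool (w L \<subseteq> v) :: real)"
        unfolding pb[OF f(1)] pb[OF f(2)] by (auto simp: w_def)
    qed
    finally show ?thesis .
  qed
  have finV: "finite ?V" by simp
  have "(\<Sum>v\<in>?V. pair_sign D r u * pair_sign D r v)
      = (\<Sum>L\<in>Pow ?R. \<Sum>v\<in>?V. (- 1) ^ (r - card L) * of_bool (w L \<subseteq> v))"
    unfolding expand by (rule sum.swap)
  also have "\<dots> = (\<Sum>L\<in>Pow ?R. (- 1) ^ (r - card L)
      * (bin (int (card u) - int (card L)) (int t - int (card L))
      * bin (2 * int D - int (card u) - int r + int (card L)) (int j - int r - int t + int (card L))))"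
  proof (intro sum.cong refl)
    fix L assume "L \<in> Pow ?R"
    then have L: "L \<subseteq> ?R" by simp
    have "(\<Sum>v\<in>?V. of_bool (w L \<subseteq> v)) = real (card {v. w L \<subseteq> v \<and> v \<subseteq> ?S \<and> card v = j \<and> card (u \<inter> v) = t})"
      using finV by (simp add: of_bool_def sum.If_cases Int_def conj_ac)
    also have "\<dots> = bin (int (card u) - int (card L)) (int t - int (card L))
      * bin (2 * int D - int (card u) - int r + int (card L)) (int j - int r - int t + int (card L))"
      using card_supersets_eq_bin[OF _ u(1) w_S[OF L], of j t] card_w[OF L] card_uw[OF L] by simp
    finally show "(\<Sum>v\<in>?V. (- 1) ^ (r - card L) * of_bool (w L \<subseteq> v)) = (- 1) ^ (r - card L)
      * (bin (int (card u) - int (card L)) (int t - int (card L))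
      * bin (2 * int D - int (card u) - int r + int (card L)) (int j - int r - int t + int (card L)))"
      by (simp add: sum_distrib_left[symmetric])
  qed
  also have "\<dots> = (\<Sum>l = 0..r. real (r choose l) * ((- 1) ^ (r - l)
      * (bin (int (card u) - int l) (int t - int l)
      * bin (2 * int D - int (card u) - int r + int l) (int j - int r - int t + int l))))"
    by (subst sum_Pow_card) simp_all
  also have "\<dots> = (\<Sum>l = 0..r. (- 1) ^ (r - l) * bin (int r) (int l)
        * bin (int (card u) - int l) (int t - int l)
        * bin (2 * int D - int (card u) - int r + int l) (int j - int r - int t + int l))"
    by (intro sum.cong refl) (simp add: bin_def[of "int r"] mult_ac)
  finally show ?thesis .
qed

text \<open>A transversal set is a choice of one element from each of the \<open>r\<close> pairs,
  giving the power of 2, together with \<open>i - r\<close> of the \<open>2D - 2r\<close> elements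
  outside the pairs.\<close>

lemma card_transversals:
  assumes r: "r \<le> D"
  shows "real (card {u. u \<subseteq> {1..2 * D} \<and> card u = i \<and> transversal D r u})
    = 2 ^ r * bin (2 * int D - 2 * int r) (int i - int r)"
proof -
  let ?S = "{1..2 * D}" and ?R = "{1..r}"
  let ?P = "?R \<union> {D + 1..D + r}"
  let ?B = "{b. b \<subseteq> ?S - ?P \<and> int (card b) = int i - int r}"
  let ?tr = "\<lambda>T. T \<union> (\<lambda>k. k + D) ` (?R - T)"
  let ?h = "\<lambda>(T, b). ?tr T \<union> b"
  have P: "card ?P = 2 * r" "?P \<subseteq> ?S"
    using r by (simp_all add: card_Un_disjoint)
  have trP: "?tr T \<subseteq> ?P" if "T \<subseteq> ?R" for T
    using that by auto
  have card_tr: "card (?tr T) = r" if "T \<subseteq> ?R" for T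
  proof -
    have f: "finite T" using that finite_subset by blast
    have "card (?tr T) = card T + card ((\<lambda>k. k + D) ` (?R - T))"
      using that r f by (intro card_Un_disjoint) auto
    also have "\<dots> = card T + card (?R - T)" by (simp add: card_image inj_on_def)
    also have "\<dots> = r" using that f card_mono[OF _ that] by (simp add: card_Diff_subset)
    finally show ?thesis .
  qed
  have card_un: "card (?tr T \<union> b) = r + card b" if "T \<subseteq> ?R" "b \<subseteq> ?S - ?P" for T b
  proof -
    have "?tr T \<inter> b = {}" using trP[OF that(1)] that(2) by blast
    moreover have "finite (?tr T)" "finite b"
      using trP[OF that(1)] that(2) by (auto intro: finite_subset)
    ultimately show ?thesis using card_tr[OF that(1)] by (simp only: card_Un_disjoint)
  qed
  have inj: "inj_on ?h (Pow ?R \<times> ?B)"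
    by (rule inj_on_inverseI[where g = "\<lambda>u. (u \<inter> ?R, u - ?P)"]) (use r in auto)
  have "{u. u \<subseteq> ?S \<and> card u = i \<and> transversal D r u} = ?h ` (Pow ?R \<times> ?B)"
  proof (intro set_eqI iffI)
    fix u assume "u \<in> {u. u \<subseteq> ?S \<and> card u = i \<and> transversal D r u}"
    then have u: "u \<subseteq> ?S" "card u = i" "transversal D r u" by auto
    let ?T = "u \<inter> ?R" and ?b = "u - ?P"
    have "u \<inter> {D + 1..D + r} = (\<lambda>k. k + D) ` (?R - ?T)"
    proof (intro set_eqI iffI)
      fix x assume x: "x \<in> u \<inter> {D + 1..D + r}"
      then have "x - D \<in> ?R" "x = (x - D) + D" by auto
      moreover from this have "x - D \<notin> u" using u(3) x unfolding transversal_def by (metis IntD1)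
      ultimately have "x - D \<in> ?R - ?T" "x = (\<lambda>k. k + D) (x - D)" by auto
      then show "x \<in> (\<lambda>k. k + D) ` (?R - ?T)" by (rule rev_image_eqI)
    next
      fix x assume "x \<in> (\<lambda>k. k + D) ` (?R - ?T)"
      then obtain k where "k \<in> ?R" "k \<notin> u" "x = k + D" by blast
      moreover from this have "k + D \<in> u" using u(3) unfolding transversal_def by blast
      ultimately show "x \<in> u \<inter> {D + 1..D + r}" by simp
    qed
    then have eq: "u = ?tr ?T \<union> ?b" by blast
    have "card u = r + card ?b" using card_un[of ?T ?b] u(1) eq by auto
    then have "(?T, ?b) \<in> Pow ?R \<times> ?B" using u by auto
    moreover have "u = ?h (?T, ?b)" using eq by simp
    ultimately show "u \<in> ?h ` (Pow ?R \<times> ?B)" by (rule rev_image_eqI)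
  next
    fix u assume "u \<in> ?h ` (Pow ?R \<times> ?B)"
    then obtain T b where Tb: "T \<subseteq> ?R" "b \<in> ?B" "u = ?tr T \<union> b" by auto
    have "transversal D r u" using Tb r unfolding transversal_def by auto
    moreover have "card u = i" using card_un[OF Tb(1), of b] Tb by auto
    moreover have "u \<subseteq> ?S" using Tb trP[OF Tb(1)] P(2) by blast
    ultimately show "u \<in> {u. u \<subseteq> ?S \<and> card u = i \<and> transversal D r u}" by auto
  qed
  then have "real (card {u. u \<subseteq> ?S \<and> card u = i \<and> transversal D r u}) = 2 ^ r * real (card ?B)"
    by (simp only: card_image[OF inj] card_cartesian_product card_Pow) (simp add: card_Pow)
  also have "real (card ?B) = bin (int (card (?S - ?P))) (int i - int r)"
    by (intro card_subsets_eq_bin) simp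
  also have "card (?S - ?P) = 2 * D - 2 * r"
    using P by (subst card_Diff_subset) auto
  finally show ?thesis using r by (simp add: of_nat_diff)
qed

text \<open>The inner sum is the same for all transversal \<open>u\<close> of size \<open>i\<close>,
  so it is multiplied by their number. This combinatorial meaning exposes symmetries that the
  alternating formula hides.\<close>

lemma pair_sign_orbit_sum:
  assumes r: "r \<le> D"
  shows "(\<Sum>u | u \<subseteq> {1..2 * D} \<and> card u = i.
      \<Sum>v | v \<subseteq> {1..2 * D} \<and> card v = j \<and> card (u \<inter> v) = t. pair_sign D r u * pair_sign D r v)
    = 2 ^ r * orbit_coeff D r i j t"
proof -
  let ?S = "{1..2 * D}"
  let ?f = "\<lambda>u. \<Sum>v | v \<subseteq> ?S \<and> card v = j \<and> card (u \<inter> v) = t. pair_sign D r u * pair_sign D r v"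
  let ?U = "{u. u \<subseteq> ?S \<and> card u = i \<and> transversal D r u}"
  have "(\<Sum>u | u \<subseteq> ?S \<and> card u = i. ?f u) = (\<Sum>u\<in>?U. ?f u)"
    by (rule sum.mono_neutral_right) (auto simp: pair_sign_eq_0)
  also have "\<dots> = (\<Sum>u\<in>?U. \<Sum>l = 0..r. (- 1) ^ (r - l) * bin (int r) (int l)
        * bin (int i - int l) (int t - int l)
        * bin (2 * int D - int i - int r + int l) (int j - int r - int t + int l))"
    by (intro sum.cong refl) (use pair_sign_mult_sum[OF r] in auto)
  also have "\<dots> = 2 ^ r * orbit_coeff D r i j t"
    using card_transversals[OF r, of i] by (simp add: orbit_coeff_def)
  finally show ?thesis .
qed

text \<open>The formula treats \<open>i\<close> and \<open>j\<close> differently, but the sum over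
  pairs \<open>(u, v)\<close> can be taken in either order.\<close>

lemma orbit_coeff_commute:
  assumes r: "r \<le> D"
  shows "orbit_coeff D r i j t = orbit_coeff D r j i t"
proof -
  let ?S = "{1..2 * D}"
  have "(\<Sum>u | u \<subseteq> ?S \<and> card u = i. \<Sum>v | v \<subseteq> ?S \<and> card v = j \<and> card (u \<inter> v) = t. pair_sign D r u * pair_sign D r v)
    = (\<Sum>u\<in>{u. u \<subseteq> ?S \<and> card u = i}. \<Sum>v | v \<in> {v. v \<subseteq> ?S \<and> card v = j} \<and> card (u \<inter> v) = t. pair_sign D r u * pair_sign D r v)"
    by (simp add: conj_ac)
  also have "\<dots> = (\<Sum>v\<in>{v. v \<subseteq> ?S \<and> card v = j}. \<Sum>u | u \<in> {u. u \<subseteq> ?S \<and> card u = i} \<and> card (u \<inter> v) = t. pair_sign D r u * pair_sign D r v)"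
    by (rule sum.swap_restrict) auto
  also have "\<dots> = (\<Sum>v | v \<subseteq> ?S \<and> card v = j. \<Sum>u | u \<subseteq> ?S \<and> card u = i \<and> card (v \<inter> u) = t. pair_sign D r v * pair_sign D r u)"
    by (simp add: conj_ac Int_commute mult.commute)
  finally show ?thesis unfolding pair_sign_orbit_sum[OF r] by simp
qed

text \<open>Replacing a \<open>D\<close>-set \<open>u\<close> by its complement gives a
  \<open>D\<close>-set again, exchanges intersection sizes \<open>t\<close> and
  \<open>j - t\<close>, and leaves the sign unchanged because \<open>r\<close> is even.\<close>

lemma orbit_coeff_reflect:
  assumes r: "r \<le> D" "even r" and t: "t \<le> j"
  shows "orbit_coeff D r D j (j - t) = orbit_coeff D r D j t"
proof -
  let ?S = "{1..2 * D}"
  let ?U = "{u. u \<subseteq> ?S \<and> card u = D}"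
  let ?f = "\<lambda>t u. \<Sum>v | v \<subseteq> ?S \<and> card v = j \<and> card (u \<inter> v) = t. pair_sign D r u * pair_sign D r v"
  have "(\<Sum>u\<in>?U. ?f (j - t) u) = (\<Sum>u\<in>?U. ?f t u)"
  proof (rule sum.reindex_bij_witness[where i = "\<lambda>u. ?S - u" and j = "\<lambda>u. ?S - u"])
    fix u assume u: "u \<in> ?U"
    show "?S - (?S - u) = u" "?S - (?S - u) = u" using u by auto
    have "finite u" using u finite_subset by blast
    then have "card (?S - u) = D" using u by (simp add: card_Diff_subset)
    then show "?S - u \<in> ?U" "?S - u \<in> ?U" by auto
    have "card ((?S - u) \<inter> v) = t \<longleftrightarrow> card (u \<inter> v) = j - t" if v: "v \<subseteq> ?S" "card v = j" for v
    proof -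
      have fin: "finite v" using v finite_subset by blast
      have "(?S - u) \<inter> v = v - u \<inter> v" using v by auto
      then have "card ((?S - u) \<inter> v) = card v - card (u \<inter> v)"
        using fin by (simp add: card_Diff_subset)
      moreover have "card (u \<inter> v) \<le> card v" using fin by (intro card_mono) auto
      ultimately show ?thesis using v t by auto
    qed
    then show "?f t (?S - u) = ?f (j - t) u"
      using pair_sign_Diff[OF r(1), of u] r(2) by (intro sum.cong) auto
  qed
  then show ?thesis unfolding pair_sign_orbit_sum[OF r(1)] by simp
qed

section \<open>The coefficients of the program\<close>

text \<open>The index set keeps only the upper half of the range of \<open>t\<close> when
  \<open>i = D\<close> or \<open>j = D\<close>. Doubling restores the lower half, and the weight 1/2
  in \<open>beta\<close> prevents the self-paired middle term from counting twice.\<close>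

lemma sum_fold_half:
  fixes F :: "nat \<Rightarrow> real"
  assumes "\<And>t. t \<le> n \<Longrightarrow> F (n - t) = F t"
  shows "(\<Sum>t = (n + 1) div 2..n. (if 2 * t = n then 1 / 2 else 1) * (2 * F t)) = (\<Sum>t = 0..n. F t)"
proof -
  let ?h = "\<lambda>t. (if 2 * t = n then 1 / 2 else 1) * F t"
  let ?A = "{t \<in> {0..n}. n \<le> 2 * t}" and ?B = "{t \<in> {0..n}. 2 * t \<le> n}"
  \<comment> \<open>The middle term satisfies both conditions and is shared equally between the two
    halves.\<close>
  have "(\<Sum>t = 0..n. F t) = (\<Sum>t = 0..n. (if n \<le> 2 * t then ?h t else 0) + (if 2 * t \<le> n then ?h t else 0))"
    by (intro sum.cong) auto
  also have "\<dots> = sum ?h ?A + sum ?h ?B"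
    by (simp only: sum.distrib sum.inter_filter finite_atLeastAtMost)
  also have "sum ?h ?B = sum ?h ?A"
    by (rule sum.reindex_bij_witness[where i = "\<lambda>t. n - t" and j = "\<lambda>t. n - t"]) (use assms in auto)
  also have "?A = {(n + 1) div 2..n}" by auto
  also have "sum ?h {(n + 1) div 2..n} + sum ?h {(n + 1) div 2..n}
      = (\<Sum>t = (n + 1) div 2..n. (if 2 * t = n then 1 / 2 else 1) * (2 * F t))"
    unfolding sum.distrib[symmetric] by (intro sum.cong) auto
  finally show ?thesis by simp
qed

text \<open>Pairing \<open>l\<close> with \<open>r - l\<close> produces the two-term summands and
  the separate middle term of cases (b) and (d); the objective is folded in the same way.\<close>

lemma sum_pair_up:
  fixes T :: "nat \<Rightarrow> real"
  assumes "even r"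
  shows "(\<Sum>l = 0..r. T l) = (\<Sum>l = r div 2 + 1..r. T l + T (r - l)) + T (r div 2)"
proof -
  obtain m where r: "r = 2 * m" using assms by blast
  have "{0..r} = {0..<m} \<union> ({m} \<union> {m + 1..r})" using r by auto
  moreover have "sum T ({0..<m} \<union> ({m} \<union> {m + 1..r})) = sum T {0..<m} + sum T ({m} \<union> {m + 1..r})"
    by (rule sum.union_disjoint) auto
  ultimately have "(\<Sum>l = 0..r. T l) = sum T {0..<m} + (T m + sum T {m + 1..r})"
    by simp
  also have "sum T {0..<m} = (\<Sum>l = m + 1..r. T (r - l))"
    by (rule sum.reindex_bij_witness[where i = "\<lambda>t. r - t" and j = "\<lambda>t. r - t"]) (use r in auto)
  finally show ?thesis using r by (simp add: sum.distrib)
qed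

section \<open>Identification of the given coefficients with signed pair counts\<close>

lemma bin_eq_0: "a < b \<Longrightarrow> bin a b = 0"
  by (simp add: bin_def)

lemma minus_one_power_diff: "even r \<Longrightarrow> l \<le> r \<Longrightarrow> (- 1 :: real) ^ (r - l) = (- 1) ^ l"
  by (simp add: minus_one_power_iff)

lemma bin_int_symmetric: "l \<le> r \<Longrightarrow> bin (int r) (int (r - l)) = bin (int r) (int l)"
  by (subst (2) bin_symmetric) (simp add: of_nat_diff)

lemma beta_generic_less_less:
  assumes "r \<le> i" "i < D" "j < D"
  shows "beta_generic D r i j t = orbit_coeff D r i j t"
proof -
  have "(\<Sum>l = 0..D - 1. (- 1) ^ (r - l) * bin (int r) (int l)
        * bin (int i - int l) (int t - int l)
        * bin (2 * int D - int i - int r + int l) (int j - int r - int t + int l))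
     = (\<Sum>l = 0..r. (- 1) ^ (r - l) * bin (int r) (int l)
        * bin (int i - int l) (int t - int l)
        * bin (2 * int D - int i - int r + int l) (int j - int r - int t + int l))"
    using assms by (intro sum.mono_neutral_right) (auto simp: bin_eq_0)
  then show ?thesis using assms by (simp add: beta_generic_def orbit_coeff_def)
qed

text \<open>The two products in case (b) are the summands of \<open>orbit_coeff\<close> at
  \<open>l\<close> and \<open>r - l\<close>: for even \<open>r\<close> their signs agree, and so do
  the binomials \<open>bin r l\<close>.\<close>

lemma beta_generic_eq_less:
  assumes r: "even r" "r \<le> j" and j: "j < D"
  shows "beta_generic D r D j t = 2 * orbit_coeff D r D j t"
proof -
  define T where "T l = (- 1) ^ (r - l) * bin (int r) (int l)
        * bin (int D - int l) (int t - int l)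
        * bin (2 * int D - int D - int r + int l) (int j - int r - int t + int l)" for l
  let ?G = "\<lambda>l. (- 1) ^ (r - l) * bin (int r) (int l) *
           (bin (int D - int l) (int t - int l)
              * bin (int D - int r + int l) (int j - int t - int r + int l)
            + bin (int D - int r + int l) (int t - int r + int l)
              * bin (int D - int l) (int j - int t - int l))"
  have G: "?G l = T l + T (r - l)" if "l \<le> r" for l
    using that minus_one_power_diff[OF r(1) that] bin_int_symmetric[OF that]
    unfolding T_def by (simp add: of_nat_diff algebra_simps)
  have mid: "T (r div 2) = bin (int D - int (r div 2)) (int t - int (r div 2))
          * bin (int D - int (r div 2)) (int j - int t - int (r div 2))
          * (- 1) ^ (r div 2) * bin (int r) (int (r div 2))"
    using r(1) unfolding T_def by (auto elim!: evenE simp: algebra_simps)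
  have "(\<Sum>l = r div 2 + 1..D - 1. ?G l) = (\<Sum>l = r div 2 + 1..r. ?G l)"
    using r j by (intro sum.mono_neutral_right) (auto simp: bin_eq_0)
  also have "\<dots> = (\<Sum>l = r div 2 + 1..r. T l + T (r - l))"
    by (intro sum.cong refl G) simp
  finally have "(\<Sum>l = r div 2 + 1..D - 1. ?G l) + T (r div 2) = (\<Sum>l = 0..r. T l)"
    using sum_pair_up[OF r(1), of T] by simp
  then show ?thesis
    using j unfolding beta_generic_def orbit_coeff_def mid T_def[symmetric] by simp
qed

text \<open>Applying \<open>bin a b = bin a (a - b)\<close> to both factors of the second product
  turns it into the first product with \<open>t\<close> replaced by \<open>i - t\<close>.\<close>

lemma beta_generic_less_eq:
  assumes r: "r \<le> i" and i: "i < D" and t: "t \<le> i"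
  shows "beta_generic D r i D t = orbit_coeff D r i D t + orbit_coeff D r i D (i - t)"
proof -
  define T where "T t l = (- 1) ^ (r - l) * bin (int r) (int l)
        * bin (int i - int l) (int t - int l)
        * bin (2 * int D - int i - int r + int l) (int D - int r - int t + int l)" for t l
  let ?G = "\<lambda>l. (- 1) ^ (r - l) * bin (int r) (int l) *
          (bin (int i - int l) (int t - int l)
             * bin (2 * int D - int r - int i + int l) (int D - int r - int t + int l)
           + bin (int i - int l) (int t)
             * bin (2 * int D - int r - int i + int l) (int D - int t))"
  have "bin (int i - int l) (int t) = bin (int i - int l) (int (i - t) - int l)"
    "bin (2 * int D - int r - int i + int l) (int D - int t)
      = bin (2 * int D - int i - int r + int l) (int D - int r - int (i - t) + int l)" for l
    using t bin_symmetric[of "int i - int l" "int t"]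
      bin_symmetric[of "2 * int D - int r - int i + int l" "int D - int t"]
    by (simp_all add: of_nat_diff algebra_simps)
  then have G: "?G l = T t l + T (i - t) l" for l
    unfolding T_def by (simp add: algebra_simps)
  have "(\<Sum>l = 0..D - 1. ?G l) = (\<Sum>l = 0..r. ?G l)"
    using r i by (intro sum.mono_neutral_right) (auto simp: bin_eq_0)
  also have "\<dots> = (\<Sum>l = 0..r. T t l) + (\<Sum>l = 0..r. T (i - t) l)"
    unfolding G sum.distrib ..
  finally show ?thesis
    using i unfolding beta_generic_def orbit_coeff_def T_def[symmetric] by (simp add: distrib_left)
qed

text \<open>As for \<open>j < D\<close>, the products belong to \<open>l\<close> and
  \<open>r - l\<close>, once their lower arguments are reflected. One factor 2 stands in front of
  the formula and another inside it.\<close>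

lemma beta_generic_eq_eq:
  assumes r: "even r" "r < D"
  shows "beta_generic D r D D t = 4 * orbit_coeff D r D D t"
proof -
  define T where "T l = (- 1) ^ (r - l) * bin (int r) (int l)
        * bin (int D - int l) (int t - int l)
        * bin (2 * int D - int D - int r + int l) (int D - int r - int t + int l)" for l
  let ?G = "\<lambda>l. 2 * (- 1) ^ (r - l) * bin (int r) (int l) *
           (bin (int D - int l) (int t - int l) * bin (int D - int r + int l) (int t)
            + bin (int D - int l) (int t) * bin (int D - int r + int l) (int D - int t))"
  have b: "bin (int D - int r + int l) (int t) = bin (int D - int r + int l) (int D - int r - int t + int l)"
    "bin (int D - int l) (int t) = bin (int D - int l) (int D - int t - int l)"
    "bin (int D - int r + int l) (int D - int t) = bin (int D - int r + int l) (int t - int r + int l)" for l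
    using bin_symmetric[of "int D - int r + int l" "int t"] bin_symmetric[of "int D - int l" "int t"]
      bin_symmetric[of "int D - int r + int l" "int D - int t"]
    by (simp_all add: algebra_simps)
  have G: "?G l = 2 * (T l + T (r - l))" if "l \<le> r" for l
    using that minus_one_power_diff[OF r(1) that] bin_int_symmetric[OF that]
    unfolding T_def b by (simp add: of_nat_diff algebra_simps)
  have mid: "2 * T (r div 2) = 2 * (- 1) ^ (r div 2) * bin (int r) (int (r div 2))
          * bin (int D - int (r div 2)) (int D - int t) * bin (int D - int (r div 2)) (int t)"
  proof -
    obtain m where m: "r = 2 * m" using r(1) by blast
    show ?thesis using b(1)[of m] b(3)[of m] unfolding T_def m by (simp add: algebra_simps)
  qed
  have "(\<Sum>l = r div 2 + 1..D - 1. ?G l) = (\<Sum>l = r div 2 + 1..r. ?G l)"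
    using r by (intro sum.mono_neutral_right) (auto simp: bin_eq_0)
  also have "\<dots> = (\<Sum>l = r div 2 + 1..r. 2 * (T l + T (r - l)))"
    by (intro sum.cong refl G) simp
  also have "\<dots> = 2 * (\<Sum>l = r div 2 + 1..r. T l + T (r - l))"
    by (simp only: sum_distrib_left)
  finally have "(\<Sum>l = r div 2 + 1..D - 1. ?G l) + 2 * T (r div 2) = 2 * (\<Sum>l = 0..r. T l)"
    using sum_pair_up[OF r(1), of T] by simp
  then show ?thesis
    using r unfolding beta_generic_def orbit_coeff_def mid T_def[symmetric] by simp
qed

text \<open>Here the outer binomial is 1, and the two inner ones require \<open>l \<le> t\<close>
  and \<open>t \<le> l\<close>, so a single summand survives.\<close>

lemma beta_generic_top:
  assumes t: "D div 2 \<le> t" "t \<le> D"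
  shows "beta_generic D D D D t = orbit_coeff D D D D t"
proof -
  have "orbit_coeff D D D D t = (\<Sum>l = 0..D. (- 1) ^ (D - l) * bin (int D) (int l)
        * bin (int D - int l) (int t - int l) * bin (int l) (int l - int t))"
    by (simp add: orbit_coeff_def bin_def[of 0] algebra_simps)
  also have "\<dots> = (\<Sum>l\<in>{t}. (- 1) ^ (D - l) * bin (int D) (int l)
        * bin (int D - int l) (int t - int l) * bin (int l) (int l - int t))"
    using t by (intro sum.mono_neutral_right) (auto simp: bin_def)
  also have "\<dots> = (- 1) ^ (D - t) * bin (int D) (int t)"
    using t by (simp add: bin_def)
  finally show ?thesis using t by (simp add: beta_generic_def)
qed

text \<open>The bound on \<open>i + j - t\<close> follows from the other conditions except at the
  triple \<open>(D, D, D div 2)\<close> for \<open>D = 2\<close>, which the definition adjoins: if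
  one index is \<open>D\<close>, then \<open>t\<close> is at least half of the other.\<close>

lemma index_set_eq:
  assumes "2 \<le> D" "even D"
  shows "index_set D = {(i, j, t). t \<le> i \<and> t \<le> j \<and> i \<le> D \<and> j \<le> D
        \<and> (i = D \<longrightarrow> (j + 1) div 2 \<le> t) \<and> (j = D \<longrightarrow> (i + 1) div 2 \<le> t)}"
proof -
  obtain m where m: "D = 2 * m" using assms by blast
  have "i + j - t \<le> 2 * D - 2 \<or> (i, j, t) = (D, D, D div 2)"
    if "t \<le> i" "t \<le> j" "i \<le> D" "j \<le> D" "i = D \<longrightarrow> (j + 1) div 2 \<le> t" "j = D \<longrightarrow> (i + 1) div 2 \<le> t" for i j t
  proof -
    consider "i < D" "j < D" | "i = D" "j < D" | "i < D" "j = D" | "i = D" "j = D"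
      using le_neq_implies_less \<open>i \<le> D\<close> \<open>j \<le> D\<close> by blast
    then show ?thesis
    proof cases
      case 2
      then have "j \<le> 2 * t" using that by linarith
      then show ?thesis using 2 that assms(1) by linarith
    next
      case 3
      then have "i \<le> 2 * t" using that by linarith
      then show ?thesis using 3 that assms(1) by linarith
    next
      case 4
      then have "D \<le> 2 * t" using that by linarith
      then show ?thesis using 4 that assms(1) m by (cases "t = m") auto
    qed (use that assms(1) in linarith)
  qed
  then show ?thesis unfolding index_set_def using m by auto
qed

text \<open>Common to both families of blocks. Testing \<open>K\<close> on the vectors
  \<open>pair_sign D r\<close>, restricted to the layers of fixed cardinality, gives a matrix
  \<open>Q\<close>; entries of the block are those of \<open>Q\<close> up to positive factors. The
  reflection hypotheses let the halved range of \<open>t\<close> stand for the full one.\<close>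

lemma psd_on_blocks:
  fixes K :: "nat set \<Rightarrow> nat set \<Rightarrow> real"
  assumes D: "2 \<le> D" "even D" and r: "r \<le> D" and J: "J = (if even r then {r..D} else {r..D - 1})"
    and sym: "\<And>u v. K u v = K v u"
    and psd: "\<And>f. 0 \<le> (\<Sum>u\<in>Pow {1..2 * D}. \<Sum>v\<in>Pow {1..2 * D}. f u * K u v * f v)"
    and K: "\<And>u v. u \<subseteq> {1..2 * D} \<Longrightarrow> v \<subseteq> {1..2 * D} \<Longrightarrow> K u v = y (card u) (card v) (card (u \<inter> v))"
    and reflect: "\<And>j t. t \<le> j \<Longrightarrow> j \<le> D \<Longrightarrow> y D j (j - t) = y D j t"
      "\<And>i t. t \<le> i \<Longrightarrow> i \<le> D \<Longrightarrow> y i D (i - t) = y i D t"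
  shows "psd_on J (\<lambda>i j. \<Sum>t | (i, j, t) \<in> index_set D. beta D r i j t * y i j t)"
proof -
  let ?S = "{1..2 * D}"
  let ?L = "\<lambda>i. {u. u \<subseteq> ?S \<and> card u = i}"
  let ?g = "pair_sign D r"
  define B where "B i j = (\<Sum>t | (i, j, t) \<in> index_set D. beta D r i j t * y i j t)" for i j
  define Q where "Q i j = (\<Sum>u\<in>?L i. \<Sum>v\<in>?L j. ?g u * K u v * ?g v)" for i j
  have J_le: "r \<le> i" "i \<le> D" "i = D \<Longrightarrow> even r" if "i \<in> J" for i
    using that J D by (auto split: if_splits)
  have finJ: "finite J" using J by simp
  have Q_sym: "Q i j = Q j i" for i j
    unfolding Q_def by (subst sum.swap) (simp add: sym[of _ "_ :: nat set"] mult_ac)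
  \<comment> \<open>The upper limit may be either index, since an intersection is no larger than
    either set; summands beyond the smaller index belong to no pair of sets.\<close>
  have Q_eq: "Q i j = 2 ^ r * (\<Sum>t = 0..n. orbit_coeff D r i j t * y i j t)"
    if n: "n = i \<or> n = j" for i j n
  proof -
    have "(\<Sum>v\<in>?L j. ?g u * K u v * ?g v)
        = (\<Sum>t = 0..n. \<Sum>v | v \<in> ?L j \<and> card (u \<inter> v) = t. ?g u * K u v * ?g v)" if u: "u \<in> ?L i" for u
    proof (rule sum.group[symmetric])
      show "(\<lambda>v. card (u \<inter> v)) ` ?L j \<subseteq> {0..n}"
      proof clarsimp
        fix v assume v: "v \<subseteq> {Suc 0..2 * D}" "j = card v"
        have "finite u" "finite v" using u v finite_subset by blast+
        then show "card (u \<inter> v) \<le> n" using n u v by (auto intro: card_mono)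
      qed
    qed auto
    then have "Q i j = (\<Sum>u\<in>?L i. \<Sum>t = 0..n. \<Sum>v | v \<in> ?L j \<and> card (u \<inter> v) = t. ?g u * K u v * ?g v)"
      unfolding Q_def by (intro sum.cong) auto
    also have "\<dots> = (\<Sum>t = 0..n. \<Sum>u\<in>?L i. \<Sum>v | v \<in> ?L j \<and> card (u \<inter> v) = t. ?g u * K u v * ?g v)"
      by (rule sum.swap)
    also have "\<dots> = (\<Sum>t = 0..n. \<Sum>u\<in>?L i. \<Sum>v | v \<subseteq> ?S \<and> card v = j \<and> card (u \<inter> v) = t. y i j t * (?g u * ?g v))"
      by (intro sum.cong) (auto simp: K)
    also have "\<dots> = (\<Sum>t = 0..n. y i j t * (2 ^ r * orbit_coeff D r i j t))"
      unfolding pair_sign_orbit_sum[OF r, symmetric] sum_distrib_left ..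
    finally show ?thesis by (simp add: sum_distrib_left mult_ac)
  qed
  have idx: "{t. (i, j, t) \<in> index_set D} = {t. t \<le> i \<and> t \<le> j
        \<and> (i = D \<longrightarrow> (j + 1) div 2 \<le> t) \<and> (j = D \<longrightarrow> (i + 1) div 2 \<le> t)}" if "i \<le> D" "j \<le> D" for i j
    using that unfolding index_set_eq[OF D] by auto
  have B_less: "B i j = Q i j / 2 ^ r" if ij: "i \<in> J" "j \<in> J" "i < D" "j < D" for i j
  proof -
    have "B i j = (\<Sum>t = 0..min i j. orbit_coeff D r i j t * y i j t)"
      unfolding B_def using ij J_le[OF ij(1)]
      by (intro sum.cong) (auto simp: idx beta_def beta_generic_less_less)
    then show ?thesis using Q_eq[of "min i j" i j] by (simp add: min_def)
  qed
  have B_eq_less: "B D j = Q D j / 2 ^ r" if j: "D \<in> J" "j \<in> J" "j < D" for j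
  proof -
    have ev: "even r" using J_le j by blast
    have "B D j = (\<Sum>t = (j + 1) div 2..j. (if 2 * t = j then 1 / 2 else 1) * (2 * (orbit_coeff D r D j t * y D j t)))"
      unfolding B_def using j ev J_le[OF j(2)]
      by (intro sum.cong) (auto simp: idx beta_def beta_generic_eq_less)
    also have "\<dots> = (\<Sum>t = 0..j. orbit_coeff D r D j t * y D j t)"
      using orbit_coeff_reflect[OF r ev, of _ j] reflect(1)[of _ j] j
      by (intro sum_fold_half) auto
    finally show ?thesis using Q_eq[of j D j] by simp
  qed
  have B_less_eq: "B i D = Q i D / 2 ^ r" if i: "D \<in> J" "i \<in> J" "i < D" for i
  proof -
    have ev: "even r" using J_le i by blast
    have oc: "orbit_coeff D r i D (i - t) = orbit_coeff D r i D t" if "t \<le> i" for t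
      using orbit_coeff_reflect[OF r ev that] by (simp add: orbit_coeff_commute[OF r, of i D])
    have "B i D = (\<Sum>t = (i + 1) div 2..i. (if 2 * t = i then 1 / 2 else 1) * (2 * (orbit_coeff D r i D t * y i D t)))"
      unfolding B_def using i ev J_le[OF i(2)]
      by (intro sum.cong) (auto simp: idx beta_def beta_generic_less_eq oc)
    also have "\<dots> = (\<Sum>t = 0..i. orbit_coeff D r i D t * y i D t)"
      using oc reflect(2)[of _ i] i by (intro sum_fold_half) auto
    finally show ?thesis using Q_eq[of i i D] by simp
  qed
  \<comment> \<open>The \<open>(D, D)\<close> entry of the block differs from the Gram matrix \<open>Q\<close> by a factor. For \<open>r < D\<close>
    this adds a nonnegative multiple of \<open>Q D D\<close> to the diagonal; for \<open>r = D\<close> there is no other entry.\<close>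
  define c :: real where "c = (if r = D then 1 / 2 else 2)"
  have B_eq_eq: "B D D = c * (Q D D / 2 ^ r)" if "D \<in> J"
  proof -
    have ev: "even r" using J_le that by blast
    \<comment> \<open>The multiples 4 (for \<open>r < D\<close>) and 1 (for \<open>r = D\<close>) of
      \<open>orbit_coeff\<close> are both written as \<open>c\<close> times the multiple 2 that
      \<open>sum_fold_half\<close> expects.\<close>
    have "B D D = (\<Sum>t = (D + 1) div 2..D. c * ((if 2 * t = D then 1 / 2 else 1) * (2 * (orbit_coeff D r D D t * y D D t))))"
      unfolding B_def using ev r
      by (intro sum.cong) (auto simp: idx beta_def beta_generic_eq_eq beta_generic_top c_def)
    also have "\<dots> = c * (\<Sum>t = (D + 1) div 2..D. (if 2 * t = D then 1 / 2 else 1) * (2 * (orbit_coeff D r D D t * y D D t)))"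
      by (simp only: sum_distrib_left)
    also have "(\<Sum>t = (D + 1) div 2..D. (if 2 * t = D then 1 / 2 else 1) * (2 * (orbit_coeff D r D D t * y D D t)))
        = (\<Sum>t = 0..D. orbit_coeff D r D D t * y D D t)"
      using orbit_coeff_reflect[OF r ev, of _ D] reflect(1)[of _ D]
      by (intro sum_fold_half) auto
    finally show ?thesis using Q_eq[of D D D] by simp
  qed
  have Q_psd: "0 \<le> (\<Sum>i\<in>J. \<Sum>j\<in>J. a i * Q i j * a j)" for a :: "nat \<Rightarrow> real"
  proof -
    \<comment> \<open>A coefficient vector on \<open>J\<close> is spread over the layers, weighted
      by the signs; the form of \<open>K\<close> at this function is the form of \<open>Q\<close> at
      \<open>a\<close>.\<close>
    let ?f = "\<lambda>u. if card u \<in> J then a (card u) * ?g u else 0"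
    have grp: "(\<Sum>u\<in>Pow ?S. ?f u * h u) = (\<Sum>i\<in>J. \<Sum>u\<in>?L i. a i * ?g u * h u)" for h
    proof -
      have "(\<Sum>u\<in>Pow ?S. ?f u * h u) = (\<Sum>u\<in>{u \<in> Pow ?S. card u \<in> J}. ?f u * h u)"
        by (rule sum.mono_neutral_right) auto
      also have "\<dots> = (\<Sum>i\<in>J. \<Sum>u | u \<in> {u \<in> Pow ?S. card u \<in> J} \<and> card u = i. ?f u * h u)"
        by (rule sum.group[symmetric]) (use finJ in auto)
      also have "\<dots> = (\<Sum>i\<in>J. \<Sum>u\<in>?L i. a i * ?g u * h u)"
        by (intro sum.cong) auto
      finally show ?thesis .
    qed
    have "(\<Sum>u\<in>Pow ?S. \<Sum>v\<in>Pow ?S. ?f u * K u v * ?f v) = (\<Sum>u\<in>Pow ?S. ?f u * (\<Sum>v\<in>Pow ?S. ?f v * K u v))"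
      by (simp add: sum_distrib_left mult_ac)
    also have "\<dots> = (\<Sum>i\<in>J. \<Sum>u\<in>?L i. a i * ?g u * (\<Sum>j\<in>J. \<Sum>v\<in>?L j. a j * ?g v * K u v))"
      unfolding grp ..
    also have "\<dots> = (\<Sum>i\<in>J. \<Sum>u\<in>?L i. \<Sum>j\<in>J. \<Sum>v\<in>?L j. a i * (?g u * K u v * ?g v) * a j)"
      by (simp add: sum_distrib_left mult_ac)
    also have "\<dots> = (\<Sum>i\<in>J. \<Sum>j\<in>J. \<Sum>u\<in>?L i. \<Sum>v\<in>?L j. a i * (?g u * K u v * ?g v) * a j)"
      by (intro sum.cong refl sum.swap)
    also have "\<dots> = (\<Sum>i\<in>J. \<Sum>j\<in>J. a i * Q i j * a j)"
      unfolding Q_def by (simp add: sum_distrib_left sum_distrib_right)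
    finally show ?thesis using psd[of ?f] by simp
  qed
  have Q_DD: "0 \<le> Q D D" if "D \<in> J"
  proof -
    have "(\<Sum>i\<in>J. \<Sum>j\<in>J. of_bool (i = D) * Q i j * of_bool (j = D)) = (\<Sum>i\<in>J. if i = D then (\<Sum>j\<in>J. if j = D then Q D D else 0) else 0)"
      by (intro sum.cong refl) (auto intro: sum.cong)
    also have "\<dots> = Q D D" using that finJ by simp
    finally show ?thesis using Q_psd[of "\<lambda>i. of_bool (i = D)"] by simp
  qed
  have B_eq: "B i j = Q i j / 2 ^ r" if "i \<in> J" "j \<in> J" "\<not> (i = D \<and> j = D)" for i j
    using that B_less[of i j] B_eq_less[of j] B_less_eq[of i] J_le(2)[of i] J_le(2)[of j] by fastforce
  have B_sym: "B i j = B j i" if "i \<in> J" "j \<in> J" for i j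
    using B_eq[of i j] B_eq[of j i] Q_sym[of i j] that by (cases "i = D \<and> j = D") auto
  have B_psd: "0 \<le> (\<Sum>i\<in>J. \<Sum>j\<in>J. a i * B i j * a j)" for a :: "nat \<Rightarrow> real"
  proof (cases "r = D")
    case True
    then have "J = {D}" using J D by simp
    moreover from this have "0 \<le> B D D" using B_eq_eq Q_DD by (simp add: c_def)
    ultimately show ?thesis using mult_nonneg_nonneg[OF _ zero_le_square, of "B D D" "a D"]
      by (simp add: mult_ac)
  next
    case False
    have "(\<Sum>i\<in>J. \<Sum>j\<in>J. a i * B i j * a j)
        = (\<Sum>i\<in>J. \<Sum>j\<in>J. a i * Q i j * a j / 2 ^ r + (if i = D then if j = D then a D * Q D D * a D / 2 ^ r else 0 else 0))"
      using B_eq B_eq_eq False by (intro sum.cong refl) (auto simp: c_def)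
    also have "\<dots> = (\<Sum>i\<in>J. \<Sum>j\<in>J. a i * Q i j * a j) / 2 ^ r
        + (\<Sum>i\<in>J. if i = D then (\<Sum>j\<in>J. if j = D then a D * Q D D * a D / 2 ^ r else 0) else 0)"
      by (simp add: sum.distrib sum_divide_distrib) (auto intro!: sum.cong)
    also have "(\<Sum>i\<in>J. if i = D then (\<Sum>j\<in>J. if j = D then a D * Q D D * a D / 2 ^ r else 0) else 0)
        = (if D \<in> J then a D * Q D D * a D / 2 ^ r else 0)"
      using finJ by simp
    finally have "(\<Sum>i\<in>J. \<Sum>j\<in>J. a i * B i j * a j) = (\<Sum>i\<in>J. \<Sum>j\<in>J. a i * Q i j * a j) / 2 ^ r
        + (if D \<in> J then a D * Q D D * a D / 2 ^ r else 0)" .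
    moreover have "0 \<le> a D * Q D D * a D / 2 ^ r" if "D \<in> J"
      using mult_nonneg_nonneg[OF Q_DD[OF that] zero_le_square, of "a D"] by (simp add: mult_ac)
    ultimately show ?thesis using Q_psd[of a] by simp
  qed
  show ?thesis unfolding psd_on_def B_def[symmetric] using B_sym B_psd by auto
qed

section \<open>The feasible point of an antipodal code\<close>

lemma card_sym_diff:
  assumes "finite u" "finite v"
  shows "card (sym_diff u v) + 2 * card (u \<inter> v) = card u + card v"
proof -
  have "card (sym_diff u v) = card (u - v) + card (v - u)"
    using assms by (intro card_Un_disjoint) auto
  moreover have "card (u - v) + card (u \<inter> v) = card u" "card (v - u) + card (u \<inter> v) = card v"
    using card_Diff_subset_Int[of u v] card_Diff_subset_Int[of v u] card_mono[of u "u \<inter> v"]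
      card_mono[of v "u \<inter> v"] assms by (auto simp: Int_commute)
  ultimately show ?thesis by linarith
qed

lemma mset_triple_eqD:
  fixes a :: 'a
  assumes "mset [a, b, c] = mset [i, j, k]"
  shows "(a = i \<and> b = j \<and> c = k) \<or> (a = j \<and> b = i \<and> c = k) \<or> (a = i \<and> b = k \<and> c = j)
    \<or> (a = k \<and> b = i \<and> c = j) \<or> (a = j \<and> b = k \<and> c = i) \<or> (a = k \<and> b = j \<and> c = i)"
proof -
  have pair: "(p = r \<and> q = s) \<or> (p = s \<and> q = r)" if "{#p, q#} = {#r, s#}" for p q r s :: 'a
    using that by (auto simp: add_eq_conv_ex)
  have eq: "{#a, b, c#} = {#i, j, k#}" using assms by simp
  have "a \<in># {#a, b, c#}" by simp
  then consider "a = i" | "a = j" | "a = k" unfolding eq by auto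
  then show ?thesis
  proof cases
    case 1
    then show ?thesis using pair[of b c j k] eq by auto
  next
    case 2
    then have "{#b, c#} = {#i, k#}" using eq by (simp add: add_mset_commute[of i j])
    then show ?thesis using 2 pair by blast
  next
    case 3
    then have "{#b, c#} = {#i, j#}"
      using eq by (simp add: add_mset_commute[of j k] add_mset_commute[of i k])
    then show ?thesis using 3 pair by blast
  qed
qed

locale antipodal_code =
  fixes D :: nat and B :: "nat set set"
  assumes D: "2 \<le> D" "even D"
    and sub: "B \<subseteq> Pow {1..2 * D}" and nonempty: "B \<noteq> {}"
    and antipode: "\<And>b. b \<in> B \<Longrightarrow> {1..2 * D} - b \<in> B"
begin

abbreviation S where "S \<equiv> {1..2 * D}"

abbreviation W where "W \<equiv> code_kernel S B B"

text \<open>The two sets are a standard pair with sizes \<open>i\<close>, \<open>j\<close> and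
  intersection \<open>t\<close>; by \<open>code_kernel_cong_card\<close> any other such pair inside
  \<open>S\<close> gives the same value. The denominator normalises the variable at
  \<open>(0, 0, 0)\<close> to 1.\<close>

definition point :: "nat \<Rightarrow> nat \<Rightarrow> nat \<Rightarrow> real" where
  "point i j t = W {1..i} ({1..t} \<union> {i + 1..i + j - t}) / W {} {}"

lemma finite_B: "finite B"
  using sub finite_subset by blast

lemma W_empty_pos: "0 < W {} {}"
  using nonempty finite_B by (simp add: code_kernel_empty card_gt_0_iff)

lemma finite_sub: "u \<subseteq> S \<Longrightarrow> finite u"
  using finite_subset by blast

lemma point_eq:
  assumes u: "u \<subseteq> S" and v: "v \<subseteq> S"
    and c: "card u = i" "card v = j" "card (u \<inter> v) = t"
  shows "point i j t = W u v / W {} {}"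
proof -
  have fin: "finite u" "finite v" using u v finite_sub by auto
  have t: "t \<le> i" "t \<le> j" using c fin by (auto intro!: card_mono)
  have "card (u \<union> v) \<le> card S" using u v by (intro card_mono) auto
  then have le: "i + j - t \<le> 2 * D" using card_Un_Int[OF fin] c by simp
  let ?v = "{1..t} \<union> {i + 1..i + j - t}"
  have "card ?v = j" using t by (subst card_Un_disjoint) auto
  moreover have "{1..i} \<inter> ?v = {1..t}" using t by auto
  ultimately show ?thesis
    unfolding point_def using t le c u v
    by (intro arg_cong[where f = "\<lambda>z. z / W {} {}"] code_kernel_cong_card) auto
qed

lemma point_eq_sym_diff:
  assumes "u \<subseteq> S" "v \<subseteq> S" "card u = i" "card v = j" "card (sym_diff u v) = i + j - 2 * t"
    and "t \<le> i" "t \<le> j"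
  shows "point i j t = W u v / W {} {}"
  using assms card_sym_diff[OF finite_sub finite_sub, of u v] by (intro point_eq) auto

lemma obtain_pair:
  assumes "t \<le> i" "t \<le> j" "i + j - t \<le> 2 * D"
  obtains u v where "u \<subseteq> S" "v \<subseteq> S" "card u = i" "card v = j" "card (u \<inter> v) = t"
    "card (sym_diff u v) = i + j - 2 * t" "point i j t = W u v / W {} {}"
proof -
  let ?u = "{1..i}" and ?v = "{1..t} \<union> {i + 1..i + j - t}"
  have s: "?u \<subseteq> S" "?v \<subseteq> S" using assms by auto
  have v: "card ?v = j" using assms by (subst card_Un_disjoint) auto
  have "?u \<inter> ?v = {1..t}" using assms by auto
  then have uv: "card (?u \<inter> ?v) = t" by simp
  have "card (sym_diff ?u ?v) = i + j - 2 * t"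
    using card_sym_diff[of ?u ?v] v uv by simp
  then show thesis using s v uv by (intro that[of ?u ?v]) (auto simp: point_def)
qed

lemma W_translate: "W (sym_diff u v) v = W u v"
  by (rule code_kernel_translate[OF finite_B])

lemma W_Diff_left: "u \<subseteq> S \<Longrightarrow> W (S - u) v = W u v"
  by (rule code_kernel_Diff[OF sub antipode])

lemma card_Diff_S: "u \<subseteq> S \<Longrightarrow> card (S - u) = 2 * D - card u"
  using finite_sub by (simp add: card_Diff_subset)

section \<open>Equalities and inequalities of the program\<close>

lemma index_setD:
  assumes "(i, j, t) \<in> index_set D"
  shows "t \<le> i" "t \<le> j" "i \<le> D" "j \<le> D" "i + j - t \<le> 2 * D"
    "i = D \<Longrightarrow> (j + 1) div 2 \<le> t" "j = D \<Longrightarrow> (i + 1) div 2 \<le> t"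
  using assms unfolding index_set_eq[OF D] by auto

text \<open>The sets \<open>u\<close>, \<open>v\<close> and \<open>sym_diff u v\<close> play
  symmetric roles: each is the symmetric difference of the other two, and \<open>W\<close> agrees on
  every ordered pair of them by commutation and translation. In terms of the code, three words are
  relabelled.\<close>

lemma point_permute:
  assumes ij: "(i, j, t) \<in> index_set D" and ij': "(i', j', t') \<in> index_set D"
    and m: "mset [i', j', i' + j' - 2 * t'] = mset [i, j, i + j - 2 * t]"
  shows "point i j t = point i' j' t'"
proof -
  obtain u v where uv: "u \<subseteq> S" "v \<subseteq> S" "card u = i" "card v = j"
    "card (sym_diff u v) = i + j - 2 * t" "point i j t = W u v / W {} {}"
    using obtain_pair index_setD[OF ij] by metis
  let ?w = "sym_diff u v"
  have w: "?w \<subseteq> S" using uv by blast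
  have sd: "sym_diff u ?w = v" "sym_diff v ?w = u" "sym_diff ?w u = v" "sym_diff ?w v = u" "sym_diff v u = ?w"
    by blast+
  have Ws: "W v u = W u v" "W ?w v = W u v" "W v ?w = W u v" "W ?w u = W u v" "W u ?w = W u v"
  proof -
    show 1: "W v u = W u v" by (rule code_kernel_commute)
    show 2: "W ?w v = W u v" by (rule W_translate)
    show "W v ?w = W u v" using 2 code_kernel_commute by metis
    show 3: "W ?w u = W u v" using W_translate[of v u] 1 unfolding sd by simp
    show "W u ?w = W u v" using 3 code_kernel_commute by metis
  qed
  note eq = point_eq_sym_diff[OF _ _ _ _ _ index_setD(1,2)[OF ij']]
  from mset_triple_eqD[OF m] show ?thesis
  proof (elim disjE conjE)
    assume "i' = i" "j' = j" "i' + j' - 2 * t' = i + j - 2 * t"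
    then show ?thesis using eq[of u v] uv by simp
  next
    assume "i' = j" "j' = i" "i' + j' - 2 * t' = i + j - 2 * t"
    then show ?thesis using eq[of v u] uv sd Ws by simp
  next
    assume "i' = i" "j' = i + j - 2 * t" "i' + j' - 2 * t' = j"
    then show ?thesis using eq[OF uv(1) w] uv unfolding sd Ws by simp
  next
    assume "i' = i + j - 2 * t" "j' = i" "i' + j' - 2 * t' = j"
    then show ?thesis using eq[OF w uv(1)] uv unfolding sd Ws by simp
  next
    assume "i' = j" "j' = i + j - 2 * t" "i' + j' - 2 * t' = i"
    then show ?thesis using eq[OF uv(2) w] uv unfolding sd Ws by simp
  next
    assume "i' = i + j - 2 * t" "j' = j" "i' + j' - 2 * t' = i"
    then show ?thesis using eq[OF w uv(2)] uv unfolding sd Ws by simp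
  qed
qed

text \<open>The same argument with \<open>S - sym_diff u v\<close> as the third set. The symmetric
  difference of any two of the sets is now the complement of the third, and \<open>W\<close> does
  not see complements.\<close>

lemma point_permute_antipode:
  assumes ij: "(i, j, t) \<in> index_set D" and ij': "(i', j', t') \<in> index_set D"
    and m: "mset [i', j', 2 * D - (i' + j' - 2 * t')] = mset [i, j, 2 * D - (i + j - 2 * t)]"
  shows "point i j t = point i' j' t'"
proof -
  obtain u v where uv: "u \<subseteq> S" "v \<subseteq> S" "card u = i" "card v = j"
    "card (sym_diff u v) = i + j - 2 * t" "point i j t = W u v / W {} {}"
    using obtain_pair index_setD[OF ij] by metis
  let ?w = "S - sym_diff u v"
  have w0: "sym_diff u v \<subseteq> S" using uv by blast
  have w: "?w \<subseteq> S" by blast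
  \<comment> \<open>These bounds make the truncated subtractions from \<open>2 * D\<close>
    invertible.\<close>
  have k': "i' + j' - 2 * t' \<le> 2 * D" using index_setD[OF ij'] by linarith
  have k: "i + j - 2 * t \<le> 2 * D" using index_setD[OF ij] by linarith
  have card_w: "card ?w = 2 * D - (i + j - 2 * t)" using card_Diff_S[OF w0] uv by simp
  have sd: "sym_diff u ?w = S - v" "sym_diff v ?w = S - u" "sym_diff ?w u = S - v" "sym_diff ?w v = S - u"
    "sym_diff v u = sym_diff u v" using uv by blast+
  have Ws: "W v u = W u v" "W ?w v = W u v" "W v ?w = W u v" "W ?w u = W u v" "W u ?w = W u v"
  proof -
    show 1: "W v u = W u v" by (rule code_kernel_commute)
    show 2: "W ?w v = W u v" using W_translate W_Diff_left[OF w0] by simp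
    show "W v ?w = W u v" using 2 code_kernel_commute by metis
    show 3: "W ?w u = W u v" using W_translate[of v u] 1 W_Diff_left[OF w0] unfolding sd by simp
    show "W u ?w = W u v" using 3 code_kernel_commute by metis
  qed
  note eq = point_eq_sym_diff[OF _ _ _ _ _ index_setD(1,2)[OF ij']]
  have cS: "card (S - u) = 2 * D - i" "card (S - v) = 2 * D - j" using card_Diff_S uv by auto
  from mset_triple_eqD[OF m] show ?thesis
  proof (elim disjE conjE)
    assume "i' = i" "j' = j" "2 * D - (i' + j' - 2 * t') = 2 * D - (i + j - 2 * t)"
    then show ?thesis using eq[of u v] uv k k' by simp
  next
    assume "i' = j" "j' = i" "2 * D - (i' + j' - 2 * t') = 2 * D - (i + j - 2 * t)"
    then show ?thesis using eq[of v u] uv sd Ws k k' by simp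
  next
    assume a: "i' = i" "j' = 2 * D - (i + j - 2 * t)" "2 * D - (i' + j' - 2 * t') = j"
    have c: "card (sym_diff u ?w) = i' + j' - 2 * t'" unfolding sd(1) cS(2) using a(3) k' by linarith
    show ?thesis unfolding uv(6)
      using eq[OF uv(1) w trans[OF uv(3) a(1)[symmetric]] trans[OF card_w a(2)[symmetric]] c] Ws(5) by simp
  next
    assume a: "i' = 2 * D - (i + j - 2 * t)" "j' = i" "2 * D - (i' + j' - 2 * t') = j"
    have c: "card (sym_diff ?w u) = i' + j' - 2 * t'" unfolding sd(3) cS(2) using a(3) k' by linarith
    show ?thesis unfolding uv(6)
      using eq[OF w uv(1) trans[OF card_w a(1)[symmetric]] trans[OF uv(3) a(2)[symmetric]] c] Ws(4) by simp
  next
    assume a: "i' = j" "j' = 2 * D - (i + j - 2 * t)" "2 * D - (i' + j' - 2 * t') = i"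
    have c: "card (sym_diff v ?w) = i' + j' - 2 * t'" unfolding sd(2) cS(1) using a(3) k' by linarith
    show ?thesis unfolding uv(6)
      using eq[OF uv(2) w trans[OF uv(4) a(1)[symmetric]] trans[OF card_w a(2)[symmetric]] c] Ws(3) by simp
  next
    assume a: "i' = 2 * D - (i + j - 2 * t)" "j' = j" "2 * D - (i' + j' - 2 * t') = i"
    have c: "card (sym_diff ?w v) = i' + j' - 2 * t'" unfolding sd(4) cS(1) using a(3) k' by linarith
    show ?thesis unfolding uv(6)
      using eq[OF w uv(2) trans[OF card_w a(1)[symmetric]] trans[OF uv(4) a(2)[symmetric]] c] Ws(2) by simp
  qed
qed

lemma point_nonneg: "0 \<le> point i j t"
  unfolding point_def by (intro divide_nonneg_nonneg code_kernel_nonneg)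

lemma point_0: "point 0 0 0 = 1"
  using W_empty_pos by (simp add: point_def)

lemma point_le:
  assumes "(i, j, t) \<in> index_set D"
  shows "point i j t \<le> point i 0 0"
proof -
  obtain u v where uv: "u \<subseteq> S" "v \<subseteq> S" "card u = i" "card v = j"
    "point i j t = W u v / W {} {}"
    using obtain_pair index_setD[OF assms] by metis
  have "point i 0 0 = W u {} / W {} {}" using uv by (intro point_eq) auto
  then show ?thesis using uv W_empty_pos code_kernel_le_diagonal[of S B u v]
    by (simp add: divide_right_mono)
qed

text \<open>A \<open>D\<close>-set and its complement are members of the same vertex; passing to the
  complement exchanges \<open>t\<close> and \<open>j - t\<close>.\<close>

lemma point_reflect_left:
  assumes "t \<le> j" "j \<le> D"
  shows "point D j (j - t) = point D j t"
proof -
  have le: "t \<le> D" "D + j - t \<le> 2 * D" using assms by auto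
  obtain u v where uv: "u \<subseteq> S" "v \<subseteq> S" "card u = D" "card v = j"
    "card (u \<inter> v) = t" "point D j t = W u v / W {} {}"
    using obtain_pair[OF le(1) assms(1) le(2)] by metis
  have "(S - u) \<inter> v = v - u \<inter> v" using uv by auto
  then have "card ((S - u) \<inter> v) = j - t" using finite_sub[OF uv(2)] uv by (simp add: card_Diff_subset)
  then have "point D j (j - t) = W (S - u) v / W {} {}"
    using uv card_Diff_S[of u] by (intro point_eq) auto
  then show ?thesis using uv W_Diff_left by simp
qed

lemma point_commute:
  assumes "t \<le> i" "t \<le> j" "i + j - t \<le> 2 * D"
  shows "point i j t = point j i t"
proof -
  obtain u v where uv: "u \<subseteq> S" "v \<subseteq> S" "card u = i" "card v = j"
    "card (u \<inter> v) = t" "point i j t = W u v / W {} {}"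
    using obtain_pair[OF assms] by metis
  then have "point j i t = W v u / W {} {}" by (intro point_eq) (auto simp: Int_commute)
  then show ?thesis using uv code_kernel_commute[of S B B u v] by simp
qed

lemma point_reflect_right:
  assumes "t \<le> i" "i \<le> D"
  shows "point i D (i - t) = point i D t"
  using point_reflect_left[OF assms] point_commute[of _ i D] assms by simp

text \<open>\<open>zeta\<close> selects the smaller of the sizes of \<open>sym_diff u v\<close> and
  its complement, and both sizes give the same value of \<open>point\<close>.\<close>

lemma point_zeta:
  assumes uv: "u \<subseteq> S" "v \<subseteq> S"
  shows "point (zeta D (card u) (card v) (card (u \<inter> v))) 0 0 = W (sym_diff u v) {} / W {} {}"
proof -
  let ?w = "sym_diff u v"
  have w: "?w \<subseteq> S" using uv by blast
  have k: "card u + card v - 2 * card (u \<inter> v) = card ?w"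
    using card_sym_diff[OF finite_sub finite_sub, OF uv] by simp
  have 1: "point (card ?w) 0 0 = W ?w {} / W {} {}"
    using w by (intro point_eq) auto
  have "point (2 * D - card ?w) 0 0 = W (S - ?w) {} / W {} {}"
    using w by (intro point_eq) (use card_Diff_S[OF w] in auto)
  then have 2: "point (2 * D - card ?w) 0 0 = W ?w {} / W {} {}"
    using W_Diff_left[OF w] by simp
  show ?thesis unfolding zeta_def k min_def using 1 2 by presburger
qed

section \<open>Positive semidefiniteness of both families of blocks\<close>

lemma zeta_reflect:
  assumes "t \<le> j" "j \<le> D"
  shows "zeta D D j (j - t) = zeta D D j t" "zeta D j D (j - t) = zeta D j D t"
  using assms by (auto simp: zeta_def min_def)

lemma psd_on_block1:
  assumes "r \<le> D" "J = (if even r then {r..D} else {r..D - 1})"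
  shows "psd_on J (block1 D point r)"
  unfolding block1_def
proof (rule psd_on_blocks[OF D assms, where K = "\<lambda>u v. W u v / W {} {}"])
  show "0 \<le> (\<Sum>u\<in>Pow S. \<Sum>v\<in>Pow S. f u * (W u v / W {} {}) * f v)" for f
  proof -
    have "(\<Sum>u\<in>Pow S. \<Sum>v\<in>Pow S. f u * (W u v / W {} {}) * f v)
        = (\<Sum>u\<in>Pow S. \<Sum>v\<in>Pow S. f u * W u v * f v) / W {} {}"
      by (simp add: sum_divide_distrib)
    then show ?thesis using code_kernel_psd W_empty_pos by simp
  qed
  show "W u v / W {} {} = W v u / W {} {}" for u v
    by (simp add: code_kernel_commute)
  show "W u v / W {} {} = point (card u) (card v) (card (u \<inter> v))" if "u \<subseteq> S" "v \<subseteq> S" for u v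
    using point_eq[OF that] by simp
qed (rule point_reflect_left point_reflect_right; assumption)+

text \<open>The kernel with base points outside \<open>B\<close> is positive semidefinite for the
  same reason as \<open>W\<close>, and its normalised values are the differences in the
  entries.\<close>

lemma psd_on_block2:
  assumes "r \<le> D" "J = (if even r then {r..D} else {r..D - 1})"
  shows "psd_on J (block2 D point r)"
  unfolding block2_def
proof (rule psd_on_blocks[OF D assms, where K = "\<lambda>u v. code_kernel S (Pow S - B) B u v / W {} {}"
      and y = "\<lambda>i j t. point (zeta D i j t) 0 0 - point i j t"])
  let ?K = "code_kernel S (Pow S - B) B"
  show "0 \<le> (\<Sum>u\<in>Pow S. \<Sum>v\<in>Pow S. f u * (?K u v / W {} {}) * f v)" for f
  proof -
    have "(\<Sum>u\<in>Pow S. \<Sum>v\<in>Pow S. f u * (?K u v / W {} {}) * f v)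
        = (\<Sum>u\<in>Pow S. \<Sum>v\<in>Pow S. f u * ?K u v * f v) / W {} {}"
      by (simp add: sum_divide_distrib)
    then show ?thesis using code_kernel_psd W_empty_pos by simp
  qed
  show "?K u v / W {} {} = ?K v u / W {} {}" for u v
    by (simp add: code_kernel_commute)
  show "?K u v / W {} {} = point (zeta D (card u) (card v) (card (u \<inter> v))) 0 0
      - point (card u) (card v) (card (u \<inter> v))" if "u \<subseteq> S" "v \<subseteq> S" for u v
    using point_eq[OF that] point_zeta[OF that] code_kernel_compl_base[OF _ sub that(2), of u]
    by (simp add: diff_divide_distrib)
qed (simp_all add: zeta_reflect point_reflect_left point_reflect_right)

text \<open>A nonzero sum has a nonzero summand, which exhibits a base word and two translates in
  \<open>B\<close> at the required distances.\<close>

lemma point_pos_witness: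
  assumes "(i, j, t) \<in> index_set D" "point i j t \<noteq> 0"
  obtains a b c where "a \<in> B" "b \<in> B" "c \<in> B"
    "card (sym_diff a b) = i" "card (sym_diff a c) = j" "card (sym_diff b c) = i + j - 2 * t"
proof -
  obtain u v where uv: "u \<subseteq> S" "v \<subseteq> S" "card u = i" "card v = j"
    "card (sym_diff u v) = i + j - 2 * t" "point i j t = W u v / W {} {}"
    using obtain_pair index_setD[OF assms(1)] by metis
  have "W u v \<noteq> 0" using assms uv by auto
  then obtain p a where p: "p permutes S" and a: "a \<in> B"
    and bc: "of_bool (sym_diff a (p ` u) \<in> B) * of_bool (sym_diff a (p ` v) \<in> B) \<noteq> (0 :: real)"
    unfolding code_kernel_def by (metis (no_types, lifting) mem_Collect_eq sum.neutral)
  let ?b = "sym_diff a (p ` u)" and ?c = "sym_diff a (p ` v)"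
  have "sym_diff a ?b = p ` u" "sym_diff a ?c = p ` v" "sym_diff ?b ?c = p ` sym_diff u v"
    unfolding permutes_image_sym_diff[OF p] by blast+
  moreover have "card (p ` x) = card x" for x
    using permutes_inj[OF p] by (intro card_image) (auto simp: inj_on_def)
  moreover have "?b \<in> B" "?c \<in> B" using bc by (auto simp: of_bool_def split: if_splits)
  ultimately show thesis using a uv by (intro that[of a ?b ?c]) auto
qed

text \<open>If the value were nonzero, \<open>i\<close>, \<open>j\<close>,
  \<open>i + j - 2 * t\<close> and its complement to \<open>2 * D\<close> would all be distances
  between words of \<open>B\<close>, the last one through the antipode of \<open>c\<close>.
  Distances 0 and \<open>2 * D\<close> occur within one vertex, so \<open>dist\<close> says nothing
  about them.\<close>

lemma point_eq_0:
  assumes ij: "(i, j, t) \<in> index_set D" and ne: "(i, j, t) \<noteq> (0, 0, 0)"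
    and dist: "\<And>a b. a \<in> B \<Longrightarrow> b \<in> B \<Longrightarrow> 0 < card (sym_diff a b) \<Longrightarrow> card (sym_diff a b) < 2 * D
      \<Longrightarrow> d \<le> card (sym_diff a b)"
    and short: "{i, j, i + j - 2 * t, 2 * D - (i + j - 2 * t)} \<inter> {1..d - 1} \<noteq> {}"
  shows "point i j t = 0"
proof (rule ccontr)
  assume "point i j t \<noteq> 0"
  with ij obtain a b c where abc: "a \<in> B" "b \<in> B" "c \<in> B"
    "card (sym_diff a b) = i" "card (sym_diff a c) = j" "card (sym_diff b c) = i + j - 2 * t"
    using point_pos_witness by metis
  let ?k = "i + j - 2 * t"
  note ix = index_setD[OF ij]
  have i: "i = 0 \<or> d \<le> i" using dist[of a b] abc ix D by auto
  have j: "j = 0 \<or> d \<le> j" using dist[of a c] abc ix D by auto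
  \<comment> \<open>Distance \<open>2 * D\<close> would force \<open>i = j = D\<close> and
    \<open>t = 0\<close>, but the index set demands \<open>(D + 1) div 2 \<le> t\<close>
    there.\<close>
  have k2: "?k < 2 * D"
  proof (rule ccontr)
    assume "\<not> ?k < 2 * D"
    then have "i = D" "j = D" "t = 0" using ix by linarith+
    then show False using ix D by simp
  qed
  have k: "?k = 0 \<or> d \<le> ?k" using dist[OF abc(2,3), unfolded abc(6)] k2 by blast
  have "sym_diff b (S - c) = S - sym_diff b c" using abc sub by blast
  moreover have "sym_diff b c \<subseteq> S" using abc sub by blast
  ultimately have "card (sym_diff b (S - c)) = 2 * D - ?k" using card_Diff_S[of "sym_diff b c"] abc by simp
  from dist[OF abc(2) antipode[OF abc(3)], unfolded this]
  have "0 < 2 * D - ?k \<Longrightarrow> 2 * D - ?k < 2 * D \<Longrightarrow> d \<le> 2 * D - ?k" .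
  moreover have "0 < 2 * D - ?k" "?k = 0 \<or> 2 * D - ?k < 2 * D" using k2 by linarith+
  ultimately have k': "?k = 0 \<or> d \<le> 2 * D - ?k" by blast
  consider "i \<in> {1..d - 1}" | "j \<in> {1..d - 1}" | "?k \<in> {1..d - 1}" | "2 * D - ?k \<in> {1..d - 1}"
    using short by blast
  then show False
  proof cases
    \<comment> \<open>Only \<open>d > 2 * D\<close> remains; then \<open>i\<close> and
      \<open>j\<close> are below \<open>d\<close>, hence 0, which is the excluded triple.\<close>
    case 4
    then have "?k = 0" "2 * D < d" using k' by auto
    then have "i = 0" "j = 0" using i j ix by auto
    then show False using ne ix by simp
  qed (use i j k in auto)
qed

lemma sdp_feasible_point:
  assumes "\<And>a b. a \<in> B \<Longrightarrow> b \<in> B \<Longrightarrow> 0 < card (sym_diff a b) \<Longrightarrow> card (sym_diff a b) < 2 * D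
      \<Longrightarrow> d \<le> card (sym_diff a b)"
  shows "sdp_feasible D d point"
  unfolding sdp_feasible_def
proof (intro conjI)
  show "\<forall>(i, j, t) \<in> index_set D. 0 \<le> point i j t \<and> point i j t \<le> point i 0 0"
    using point_nonneg point_le by auto
  show "\<forall>(i, j, t) \<in> index_set D. \<forall>(i', j', t') \<in> index_set D.
        i + j - 2 * t \<le> D \<and> mset [i', j', i' + j' - 2 * t'] = mset [i, j, i + j - 2 * t]
        \<longrightarrow> point i j t = point i' j' t'"
    using point_permute by blast
  show "\<forall>(i, j, t) \<in> index_set D. \<forall>(i', j', t') \<in> index_set D.
        D + 1 \<le> i + j - 2 * t \<and> i + j - 2 * t \<le> 2 * D - 2
        \<and> mset [i', j', 2 * D - (i' + j' - 2 * t')] = mset [i, j, 2 * D - (i + j - 2 * t)]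
        \<longrightarrow> point i j t = point i' j' t'"
    using point_permute_antipode by blast
  show "\<forall>(i, j, t) \<in> index_set D.
        (i, j, t) \<noteq> (0, 0, 0)
        \<and> {i, j, i + j - 2 * t, 2 * D - (i + j - 2 * t)} \<inter> {1..d - 1} \<noteq> {}
        \<longrightarrow> point i j t = 0"
    using point_eq_0 assms by blast
  show "\<forall>r \<in> {0..D}. even r \<longrightarrow> psd_on {r..D} (block1 D point r) \<and> psd_on {r..D} (block2 D point r)"
    by (intro ballI impI conjI psd_on_block1 psd_on_block2) auto
  show "\<forall>r \<in> {1..D - 1}. odd r \<longrightarrow>
        psd_on {r..D - 1} (block1 D point r) \<and> psd_on {r..D - 1} (block2 D point r)"
    by (intro ballI impI conjI psd_on_block1 psd_on_block2) auto
qed (rule point_0)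

text \<open>For fixed \<open>p\<close> and \<open>a\<close> the translate of \<open>a\<close> by the
  image of \<open>u\<close> runs bijectively over \<open>Pow S\<close>, so each inner sum is
  \<open>card B\<close>.\<close>

lemma sum_W: "(\<Sum>u\<in>Pow S. W u {}) = W {} {} * card B"
proof -
  have inner: "(\<Sum>u\<in>Pow S. of_bool (sym_diff a (p ` u) \<in> B)) = real (card B)"
    if p: "p permutes S" and a: "a \<in> B" for p a
  proof -
    let ?f = "\<lambda>u. sym_diff a (p ` u)"
    have "inj_on ?f (Pow S)"
    proof (rule inj_onI)
      fix u v assume "?f u = ?f v"
      then have "p ` u = p ` v" by blast
      then show "u = v" using permutes_inj[OF p] by (simp add: inj_image_eq_iff)
    qed
    moreover have "?f ` Pow S \<subseteq> Pow S"
      using a sub permutes_image_subset[OF p] by blast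
    ultimately have "bij_betw ?f (Pow S) (Pow S)"
      by (simp add: bij_betw_def endo_inj_surj)
    from sum.reindex_bij_betw[OF this, of "\<lambda>b. of_bool (b \<in> B)"]
    have "(\<Sum>u\<in>Pow S. of_bool (?f u \<in> B)) = (\<Sum>b\<in>Pow S. of_bool (b \<in> B) :: real)" .
    also have "\<dots> = real (card (Pow S \<inter> B))"
      by (simp add: of_bool_def sum.If_cases)
    also have "Pow S \<inter> B = B" using sub by blast
    finally show ?thesis .
  qed
  have "(\<Sum>u\<in>Pow S. W u {}) = (\<Sum>u\<in>Pow S. \<Sum>p | p permutes S. \<Sum>a\<in>B. of_bool (sym_diff a (p ` u) \<in> B))"
    unfolding code_kernel_def by (intro sum.cong) auto
  also have "\<dots> = (\<Sum>p | p permutes S. \<Sum>u\<in>Pow S. \<Sum>a\<in>B. of_bool (sym_diff a (p ` u) \<in> B))"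
    by (rule sum.swap)
  also have "\<dots> = (\<Sum>p | p permutes S. \<Sum>a\<in>B. \<Sum>u\<in>Pow S. of_bool (sym_diff a (p ` u) \<in> B))"
    by (intro sum.cong refl sum.swap)
  also have "\<dots> = (\<Sum>p | p permutes S. \<Sum>a\<in>B. real (card B))"
    using inner by (intro sum.cong) auto
  also have "\<dots> = W {} {} * card B"
    using card_permutations[of S] by (simp add: code_kernel_empty)
  finally show ?thesis .
qed

text \<open>Summing over all subsets layer by layer gives every size from 0 to \<open>2 * D\<close>.
  Sizes \<open>i\<close> and \<open>2 * D - i\<close> contribute equally, so the objective, with
  weight 1/2 at \<open>D\<close>, is half of that sum.\<close>

lemma sdp_objective_point: "2 * sdp_objective D point = card B"
proof -
  let ?T = "\<lambda>i. real (2 * D choose i) * point i 0 0"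
  have refl': "?T (2 * D - i) = ?T i" if "i \<le> 2 * D" for i
  proof -
    let ?u = "{1..i}"
    have u: "?u \<subseteq> S" using that by auto
    have "point i 0 0 = W ?u {} / W {} {}" using u by (intro point_eq) auto
    moreover have "point (2 * D - i) 0 0 = W (S - ?u) {} / W {} {}"
      using card_Diff_S[OF u] by (intro point_eq) auto
    ultimately show ?thesis
      using W_Diff_left[OF u] that by (simp add: binomial_symmetric[symmetric])
  qed
  have "real (card B) = (\<Sum>u\<in>Pow S. W u {}) / W {} {}"
    using sum_W W_empty_pos by simp
  also have "\<dots> = (\<Sum>u\<in>Pow S. point (card u) 0 0)"
    unfolding sum_divide_distrib
  proof (intro sum.cong refl)
    fix u assume "u \<in> Pow S"
    then show "W u {} / W {} {} = point (card u) 0 0" using point_eq[of u "{}" "card u" 0 0] by simp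
  qed
  also have "\<dots> = (\<Sum>i = 0..2 * D. ?T i)"
    by (subst sum_Pow_card) auto
  also have "\<dots> = (\<Sum>i = D + 1..2 * D. ?T i + ?T (2 * D - i)) + ?T D"
    by (subst sum_pair_up) auto
  also have "(\<Sum>i = D + 1..2 * D. ?T i + ?T (2 * D - i)) = (\<Sum>i = 0..D - 1. 2 * ?T i)"
    by (rule sum.reindex_bij_witness[where i = "\<lambda>i. 2 * D - i" and j = "\<lambda>i. 2 * D - i"])
      (use refl' D in auto)
  finally show ?thesis
    by (simp add: sdp_objective_def sum_distrib_left)
qed

end

section \<open>Codes in the folded cube\<close>

lemma folded_cube_vertices_eq:
  "folded_cube_vertices D = (\<lambda>u. {u, {1..2 * D} - u}) ` Pow {1..2 * D}"
proof (intro set_eqI iffI)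
  fix x assume "x \<in> folded_cube_vertices D"
  then obtain u u' where x: "x = {u, u'}" "u \<inter> u' = {}" "u \<union> u' = {1..2 * D}"
    unfolding folded_cube_vertices_def by blast
  then have "u' = {1..2 * D} - u" by blast
  then show "x \<in> (\<lambda>u. {u, {1..2 * D} - u}) ` Pow {1..2 * D}" using x by blast
next
  fix x assume "x \<in> (\<lambda>u. {u, {1..2 * D} - u}) ` Pow {1..2 * D}"
  then obtain u where "u \<subseteq> {1..2 * D}" "x = {u, {1..2 * D} - u}" by blast
  then show "x \<in> folded_cube_vertices D" unfolding folded_cube_vertices_def by blast
qed

lemma folded_cube_vertex_eq:
  assumes "x \<in> folded_cube_vertices D" "u \<in> x"
  shows "u \<subseteq> {1..2 * D}" "x = {u, {1..2 * D} - u}"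
  using assms unfolding folded_cube_vertices_eq by auto

lemma folded_cube_dist_le:
  assumes "x \<in> folded_cube_vertices D" "y \<in> folded_cube_vertices D" "u \<in> x" "v \<in> y"
  shows "folded_cube_dist x y \<le> card (sym_diff u v)"
proof -
  note x = folded_cube_vertex_eq[OF assms(1,3)] and y = folded_cube_vertex_eq[OF assms(2,4)]
  have "folded_cube_dist {u, {1..2 * D} - u} {v, {1..2 * D} - v} \<le> card (sym_diff u v)"
    using x(1) y(1) by (subst folded_cube_dist_eq_min[of _ _ D]) auto
  then show ?thesis using x(2) y(2) by simp
qed

text \<open>A member determines its vertex, so distinct vertices are disjoint; since
  \<open>S\<close> is nonempty, no set equals its complement and each vertex has two
  members.\<close>

lemma card_Union_folded_cube:
  assumes D: "0 < D" and C: "C \<subseteq> folded_cube_vertices D"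
  shows "card (\<Union>C) = 2 * card C"
proof -
  have "card x = 2" if "x \<in> C" for x
  proof -
    have "x \<in> (\<lambda>u. {u, {1..2 * D} - u}) ` Pow {1..2 * D}"
      using that C folded_cube_vertices_eq by auto
    then obtain u where u: "u \<subseteq> {1..2 * D}" "x = {u, {1..2 * D} - u}" by blast
    have "1 \<in> {1..2 * D}" using D by simp
    then have "u \<noteq> {1..2 * D} - u" by blast
    then show ?thesis using u by simp
  qed
  moreover have "pairwise disjnt C"
  proof (rule pairwiseI)
    fix x y assume xy: "x \<in> C" "y \<in> C" "x \<noteq> y"
    have "x = y" if "z \<in> x" "z \<in> y" for z
    proof -
      have "x = {z, {1..2 * D} - z}" "y = {z, {1..2 * D} - z}"
        using xy C that by (intro folded_cube_vertex_eq(2); blast)+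
      then show ?thesis by simp
    qed
    then show "disjnt x y" using xy(3) unfolding disjnt_def by blast
  qed
  moreover have "finite x" if "x \<in> C" for x
    using that C unfolding folded_cube_vertices_eq by auto
  ultimately show ?thesis using card_Union_disjoint[of C] by simp
qed

text \<open>Singletons are codes, so a maximum code is nonempty. This matters because
  \<open>point\<close> divides by \<open>W {} {}\<close>.\<close>

lemma max_code_size_attained:
  assumes V: "finite V" "v \<in> V"
  obtains C where "is_code V dst d C" "C \<noteq> {}" "card C = max_code_size V dst d"
proof -
  let ?N = "{card C | C. is_code V dst d C}"
  have "?N \<subseteq> card ` Pow V" by (auto simp: is_code_def)
  then have fin: "finite ?N" using V finite_subset by blast
  have "is_code V dst d {v}" using V by (simp add: is_code_def)
  then have 1: "1 \<in> ?N" by force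
  then have "max_code_size V dst d \<in> ?N" unfolding max_code_size_def using fin by (intro Max_in) auto
  then obtain C where C: "is_code V dst d C" "card C = max_code_size V dst d" by auto
  have "1 \<le> max_code_size V dst d" unfolding max_code_size_def using fin 1 by (intro Max_ge)
  then have "C \<noteq> {}" using C by auto
  then show thesis using C that by blast
qed

theorem theorem5p3:
  fixes D d :: nat
  assumes "2 \<le> D" and "even D" and "0 < d"
  shows "ereal (real (max_code_size (folded_cube_vertices D) folded_cube_dist d)) \<le> sdp_value D d"
proof -
  let ?V = "folded_cube_vertices D" and ?S = "{1..2 * D}"
  have "finite ?V" "{{}, ?S - {}} \<in> ?V" unfolding folded_cube_vertices_eq by auto
  then obtain C where C: "is_code ?V folded_cube_dist d C" "C \<noteq> {}"
    and card_C: "card C = max_code_size ?V folded_cube_dist d"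
    using max_code_size_attained by metis
  have CV: "C \<subseteq> ?V" using C by (simp add: is_code_def)
  have code: "d \<le> folded_cube_dist x y" if "x \<in> C" "y \<in> C" "x \<noteq> y" for x y
    using C that by (simp add: is_code_def)
  interpret antipodal_code D "\<Union>C"
  proof
    show "\<Union>C \<subseteq> Pow ?S" "\<Union>C \<noteq> {}"
      using CV C(2) unfolding folded_cube_vertices_eq by blast+
    show "?S - b \<in> \<Union>C" if b: "b \<in> \<Union>C" for b
    proof -
      obtain x where x: "x \<in> C" "b \<in> x" using b by blast
      then have "x = {b, ?S - b}" using CV by (intro folded_cube_vertex_eq(2)) auto
      then show ?thesis using x by blast
    qed
  qed (use assms in auto)
  have "sdp_feasible D d point"
  proof (rule sdp_feasible_point)
    fix a b assume ab: "a \<in> \<Union>C" "b \<in> \<Union>C" "0 < card (sym_diff a b)" "card (sym_diff a b) < 2 * D"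
    then obtain x y where xy: "x \<in> C" "a \<in> x" "y \<in> C" "b \<in> y" by blast
    then have xyV: "x \<in> ?V" "y \<in> ?V" using CV by auto
    \<comment> \<open>Two words of one vertex are equal or complementary, at distance 0 or
      \<open>2 * D\<close>.\<close>
    have "x \<noteq> y"
    proof
      assume "x = y"
      then have "b = a \<or> b = ?S - a" using xy xyV folded_cube_vertex_eq(2)[of x D a] by auto
      moreover have "sym_diff a (?S - a) = ?S" using folded_cube_vertex_eq(1)[OF xyV(1) xy(2)] by blast
      ultimately show False using ab by auto
    qed
    then have "d \<le> folded_cube_dist x y" using code xy by blast
    also have "\<dots> \<le> card (sym_diff a b)" using folded_cube_dist_le xy xyV by blast
    finally show "d \<le> card (sym_diff a b)" .
  qed
  then have "ereal (sdp_objective D point) \<le> sdp_value D d"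
    unfolding sdp_value_def by (intro SUP_upper) simp
  moreover have "sdp_objective D point = real (card C)"
    using sdp_objective_point card_Union_folded_cube[OF _ CV] assms by simp
  ultimately show ?thesis using card_C by simp
qed

end
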